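(* Let $T>0$, let $(X,m)$ be a compact metric space equipped with a Borel probability measure $m$, let $K:X\to\mathbb R$ be a continuous function, and let $\{\Phi_t\}_{0\le t\le T}$ be a continuous measure-preserving flow on $X$. For each $z\in X$, let $j_z$ be the stopped solution of $$j_z''(t)+K(\Phi_t z)\,j_z(t)=0,\qquad j_z(0)=0,\qquad j_z'(0)=1.$$ Then, for every positive integer $\mu$, $$\int_X j_z(T)^\mu\,dm(z)\le\int_X \widehat s_{K(z)}(T)^\mu\,dm(z),$$ where, for $a\in\mathbb R$, $\widehat s_a$ is the stopped solution of $$s''+as=0,\qquad s(0)=0,\qquad s'(0)=1.$$
   Context: Stopped solution: for a solution of a second-order linear ODE with the given initial data, its stopped solution is the function that agrees with the original solution up to its first positive zero, if one exists, and is identically zero thereafter (if there is no positive zero, it equals the solution). Continuous measure-preserving flow: the map $(t,z)\mapsto\Phi_t(z)$ is continuous, $\Phi_0=\mathrm{id}$, $\Phi_{s+t}=\Phi_s\circ\Phi_t$ whenever $s,t,s+t$ lie in the time interval, and $m(\Phi_t^{-1}(E))=m(E)$ for every Borel set $E\subset X$ and every $t$ in the time interval. *)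

theory Defs
  imports "HOL-Probability.Probability"
begin

text \<open>
  \<open>y\<close> solves \<open>y'' + q y = 0\<close>, \<open>y 0 = y0\<close>, \<open>y' 0 = v0\<close> on the time interval \<open>I\<close> (always
  \<open>{0..T}\<close> or \<open>{0..}\<close> below). Derivatives are one-sided at the endpoints of \<open>I\<close>.
\<close>
definition ivp_solution ::
    "real set \<Rightarrow> (real \<Rightarrow> real) \<Rightarrow> real \<Rightarrow> real \<Rightarrow> (real \<Rightarrow> real) \<Rightarrow> bool" where
  "ivp_solution I q y0 v0 y \<longleftrightarrow>
     (\<exists>y' y''.
        (\<forall>t\<in>I. (y has_real_derivative y' t) (at t within I)) \<and>
        (\<forall>t\<in>I. (y' has_real_derivative y'' t) (at t within I)) \<and>
        (\<forall>t\<in>I. y'' t + q t * y t = 0) \<and>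
        y 0 = y0 \<and> y' 0 = v0)"

definition first_positive_zero :: "real set \<Rightarrow> (real \<Rightarrow> real) \<Rightarrow> real \<Rightarrow> bool" where
  "first_positive_zero I y \<tau> \<longleftrightarrow>
     \<tau> \<in> I \<and> 0 < \<tau> \<and> y \<tau> = 0 \<and> (\<forall>t\<in>I. 0 < t \<and> t < \<tau> \<longrightarrow> y t \<noteq> 0)"

definition stopped :: "real set \<Rightarrow> (real \<Rightarrow> real) \<Rightarrow> real \<Rightarrow> real" where
  "stopped I y t = (if \<exists>\<tau>. first_positive_zero I y \<tau> \<and> \<tau> < t then 0 else y t)"

text \<open>Values outside \<open>I\<close> are left unconstrained.\<close>
definition stopped_solution ::
    "real set \<Rightarrow> (real \<Rightarrow> real) \<Rightarrow> real \<Rightarrow> real \<Rightarrow> (real \<Rightarrow> real) \<Rightarrow> bool" where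
  "stopped_solution I q y0 v0 j \<longleftrightarrow>
     (\<exists>y. ivp_solution I q y0 v0 y \<and> (\<forall>t\<in>I. j t = stopped I y t))"

definition measure_preserving_flow ::
    "real \<Rightarrow> 'a::metric_space measure \<Rightarrow> (real \<Rightarrow> 'a \<Rightarrow> 'a) \<Rightarrow> bool" where
  "measure_preserving_flow T m \<Phi> \<longleftrightarrow>
     continuous_on ({0..T} \<times> UNIV) (\<lambda>(t, z). \<Phi> t z) \<and>
     \<Phi> 0 = id \<and>
     (\<forall>s\<in>{0..T}. \<forall>t\<in>{0..T}. s + t \<in> {0..T} \<longrightarrow> \<Phi> (s + t) = \<Phi> s \<circ> \<Phi> t) \<and>
     (\<forall>t\<in>{0..T}. \<forall>E\<in>sets borel. measure m (\<Phi> t -` E) = measure m E)"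

end

theory Submission imports Defs begin

text \<open>
  Deform the potential \<open>q t = K (\<Phi> t z)\<close> along \<open>q\<^sub>\<lambda> = max q \<lambda>\<close>. As \<open>\<lambda>\<close> grows by \<open>h\<close>, the stopped
  solution at time \<open>T\<close> drops by at most \<open>\<integral> (q\<^bsub>\<lambda>+h\<^esub> - q\<^sub>\<lambda>) y y'\<close>, where \<open>y\<close> and \<open>y'\<close> solve the equation
  forward from \<open>0\<close> and backward from \<open>T\<close>. Since \<open>q\<^sub>\<lambda> \<ge> \<lambda>\<close>, Sturm comparison bounds both by the
  solutions for the constant potential \<open>\<lambda>\<close>, so the weight no longer depends on \<open>z\<close>, and by invariance
  of \<open>m\<close> the integral over \<open>X\<close> of the drop is at most \<open>\<integral> (max K (\<lambda> + h) - max K \<lambda>)\<close> times an integral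
  which, up to a shift of \<open>\<lambda>\<close> by \<open>h\<close>, is the decay rate of \<open>\<lambda> \<mapsto> s\<^sub>\<lambda> T ^ \<mu>\<close>. Summing over \<open>\<lambda>\<close>
  telescopes to \<open>\<integral> s\<^bsub>K - 2h\<^esub> T ^ \<mu>\<close>, and \<open>h\<close> tends to \<open>0\<close>.
\<close>

section \<open>Initial value problems with continuous potential\<close>

text \<open>The first-order form of the initial value problem. Naming the velocity \<open>v\<close>
  lets Wronskians be written down directly.\<close>

definition jacobi :: "real \<Rightarrow> (real \<Rightarrow> real) \<Rightarrow> (real \<Rightarrow> real) \<Rightarrow> (real \<Rightarrow> real) \<Rightarrow> bool" where
  "jacobi T q y v \<longleftrightarrow>
     y 0 = 0 \<and> v 0 = 1 \<and>
     (\<forall>t\<in>{0..T}. (y has_real_derivative v t) (at t within {0..T})) \<and>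
     (\<forall>t\<in>{0..T}. (v has_real_derivative - (q t * y t)) (at t within {0..T}))"

lemma ivp_solution_imp_jacobi:
  assumes "ivp_solution I q 0 1 y" "{0..T} \<subseteq> I"
  shows "\<exists>v. jacobi T q y v"
proof -
  obtain v a where va: "\<forall>t\<in>I. (y has_real_derivative v t) (at t within I)"
     "\<forall>t\<in>I. (v has_real_derivative a t) (at t within I)"
     "\<forall>t\<in>I. a t + q t * y t = 0" "y 0 = 0" "v 0 = 1"
    using assms(1) unfolding ivp_solution_def by blast
  have "jacobi T q y v"
    unfolding jacobi_def
  proof (intro conjI ballI)
    fix t assume t: "t \<in> {0..T}"
    then have "a t = - (q t * y t)" "t \<in> I"
      using va(3) assms(2) by (force simp: add_eq_0_iff2)+
    then show "(y has_real_derivative v t) (at t within {0..T})"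
      "(v has_real_derivative - (q t * y t)) (at t within {0..T})"
      using va(1,2) assms(2) by (metis DERIV_subset)+
  qed (use va in auto)
  then show ?thesis by blast
qed

lemma jacobi_continuous:
  assumes "jacobi T q y v"
  shows "continuous_on {0..T} y" "continuous_on {0..T} v"
  using assms unfolding jacobi_def by (intro DERIV_continuous_on, blast)+

text \<open>Each integration of the weight \<open>exp (L * x)\<close> gains a factor
  \<open>1 / L\<close>, the source of the contraction in the Picard scheme below.\<close>

lemma integral_exp_bound:
  fixes f :: "real \<Rightarrow> real"
  assumes "continuous_on {0..u} f" "0 < L" "0 \<le> C" "0 \<le> u"
    and bnd: "\<And>x. x \<in> {0..u} \<Longrightarrow> \<bar>f x\<bar> \<le> C * exp (L * x)"
  shows "\<bar>integral {0..u} f\<bar> \<le> C / L * exp (L * u)"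
proof -
  have "((\<lambda>x. C * exp (L * x)) has_integral (C / L * exp (L * u) - C / L * exp (L * 0))) {0..u}"
  proof (rule fundamental_theorem_of_calculus)
    fix x assume "x \<in> {0..u}"
    show "((\<lambda>x. C / L * exp (L * x)) has_vector_derivative C * exp (L * x)) (at x within {0..u})"
      unfolding has_real_derivative_iff_has_vector_derivative[symmetric]
      using \<open>0 < L\<close> by (auto intro!: derivative_eq_intros simp: field_simps)
  qed fact
  note hi = this
  have "norm (integral {0..u} f) \<le> integral {0..u} (\<lambda>x. C * exp (L * x))"
    using bnd hi integrable_continuous_real[OF assms(1)]
    by (intro integral_norm_bound_integral) auto
  also have "\<dots> = C / L * exp (L * u) - C / L * exp (L * 0)"
    by (rule integral_unique[OF hi])
  also have "\<dots> \<le> C / L * exp (L * u)"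
    using assms by simp
  finally show ?thesis by simp
qed

text \<open>Picard iteration; the weight \<open>exp (L t)\<close> with \<open>L\<^sup>2 \<ge> 2 sup \<bar>q\<bar>\<close> makes the increments geometric.\<close>
lemma jacobi_exists:
  assumes q: "continuous_on {0..T} q" and "0 \<le> T"
  shows "\<exists>y v. jacobi T q y v"
proof -
  have "bounded (q ` {0..T})"
    by (intro compact_imp_bounded compact_continuous_image q) simp
  then obtain M where M: "0 < M" "\<And>t. t \<in> {0..T} \<Longrightarrow> \<bar>q t\<bar> \<le> M"
    unfolding bounded_pos by auto
  \<comment> \<open>\<open>1 \<le> L\<close> gives the base bound
    \<open>t \<le> exp (L * t)\<close>. With \<open>2 * M \<le> L\<close> it makes the two
    integrations of one Picard step shrink the weighted bound by
    \<open>M / L / L \<le> 1 / 2\<close>.\<close>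
  define L where "L = 2 * M + 1"
  have L: "1 \<le> L" "0 < L" "2 * M \<le> L"
    using M by (auto simp: L_def)
  have "2 * M \<le> L * L"
    using L mult_left_mono[of 1 L L] by linarith
  then have half: "M / L / L \<le> 1 / 2"
    using L by (simp add: field_simps)
  \<comment> \<open>\<open>Y n\<close> is the n-th Picard increment, so the solution is the sum of
    the series; \<open>V n\<close> and \<open>A n\<close> are its first and second
    derivatives.\<close>
  define Y where "Y = rec_nat (\<lambda>t. t) (\<lambda>_ g t. integral {0..t} (\<lambda>u. - integral {0..u} (\<lambda>x. q x * g x)))"
  define V where "V n = (case n of 0 \<Rightarrow> \<lambda>_. 1 | Suc k \<Rightarrow> \<lambda>u. - integral {0..u} (\<lambda>x. q x * Y k x))" for n
  define A where "A n = (case n of 0 \<Rightarrow> \<lambda>_. 0 | Suc k \<Rightarrow> \<lambda>u. - (q u * Y k u))" for n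
  have Y_Suc: "Y (Suc n) t = integral {0..t} (V (Suc n))" for n t
    by (simp add: Y_def V_def)
  have Y_0: "Y 0 t = t" for t by (simp add: Y_def)
  \<comment> \<open>The velocity bound is carried for \<open>V (Suc n)\<close>: it follows from the
    bound on \<open>Y n\<close>, and integrating it yields the bound on
    \<open>Y (Suc n)\<close>.\<close>
  have main: "continuous_on {0..T} (Y n) \<and> (\<forall>t\<in>{0..T}. \<bar>Y n t\<bar> \<le> (1/2)^n * exp (L * t)) \<and>
     (\<forall>t\<in>{0..T}. (Y n has_real_derivative V n t) (at t within {0..T})) \<and>
     (\<forall>t\<in>{0..T}. (V n has_real_derivative A n t) (at t within {0..T})) \<and>
     (\<forall>t\<in>{0..T}. \<bar>V (Suc n) t\<bar> \<le> M / L * (1/2)^n * exp (L * t))" for n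
  proof (induction n)
    case 0
    have "\<bar>Y 0 t\<bar> \<le> (1/2)^0 * exp (L * t)" if "t \<in> {0..T}" for t
    proof -
      have "t \<le> L * t" using that L(1) by (simp add: mult_le_cancel_right1)
      also have "\<dots> \<le> exp (L * t)" using exp_ge_add_one_self[of "L*t"] by linarith
      finally show ?thesis using that by (simp add: Y_0)
    qed
    note Yb = this
    have cY: "continuous_on {0..T} (Y 0)" by (simp add: Y_def)
    have "\<bar>V (Suc 0) t\<bar> \<le> M / L * (1/2)^0 * exp (L * t)" if "t \<in> {0..T}" for t
    proof -
      have "\<bar>integral {0..t} (\<lambda>x. q x * Y 0 x)\<bar> \<le> M / L * exp (L * t)"
      proof (rule integral_exp_bound)
        show "continuous_on {0..t} (\<lambda>x. q x * Y 0 x)"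
          using that by (intro continuous_on_mult continuous_on_subset[OF q] continuous_on_subset[OF cY]) auto
        fix x assume "x \<in> {0..t}"
        then show "\<bar>q x * Y 0 x\<bar> \<le> M * exp (L * x)"
          using M Yb[of x] that by (auto simp: abs_mult intro!: mult_mono)
      qed (use L M that in auto)
      then show ?thesis by (simp add: V_def)
    qed
    moreover have "(Y 0 has_real_derivative V 0 t) (at t within {0..T})" for t
      by (auto simp: Y_def V_def intro!: derivative_eq_intros)
    moreover have "(V 0 has_real_derivative A 0 t) (at t within {0..T})" for t
      by (auto simp: A_def V_def intro!: derivative_eq_intros)
    ultimately show ?case using Yb cY by blast
  next
    case (Suc n)
    then have cY: "continuous_on {0..T} (Y n)" and Yb: "\<And>t. t\<in>{0..T} \<Longrightarrow> \<bar>Y n t\<bar> \<le> (1/2)^n * exp (L * t)"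
      and Vb: "\<And>t. t\<in>{0..T} \<Longrightarrow> \<bar>V (Suc n) t\<bar> \<le> M / L * (1/2)^n * exp (L * t)"
      by auto
    have dV: "(V (Suc n) has_real_derivative A (Suc n) t) (at t within {0..T})" if "t \<in> {0..T}" for t
      using that unfolding V_def A_def nat.case
      by (intro DERIV_minus integral_has_real_derivative continuous_on_mult q cY)
    then have cV: "continuous_on {0..T} (V (Suc n))"
      by (rule DERIV_continuous_on)
    have dY: "(Y (Suc n) has_real_derivative V (Suc n) t) (at t within {0..T})" if "t \<in> {0..T}" for t
      using that unfolding Y_Suc[abs_def] by (intro integral_has_real_derivative cV)
    then have cYS: "continuous_on {0..T} (Y (Suc n))"
      by (rule DERIV_continuous_on)
    have YSb: "\<bar>Y (Suc n) t\<bar> \<le> (1/2)^Suc n * exp (L * t)" if "t \<in> {0..T}" for t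
    proof -
      have "\<bar>Y (Suc n) t\<bar> \<le> (M / L * (1/2)^n) / L * exp (L * t)"
        unfolding Y_Suc
        by (rule integral_exp_bound[OF continuous_on_subset[OF cV]]) (use Vb that L M in auto)
      also have "\<dots> = (M / L / L) * ((1/2)^n * exp (L * t))" by simp
      also have "\<dots> \<le> (1/2) * ((1/2)^n * exp (L * t))"
        by (intro mult_right_mono half) auto
      finally show ?thesis by simp
    qed
    have "\<bar>V (Suc (Suc n)) t\<bar> \<le> M / L * (1/2)^Suc n * exp (L * t)" if "t \<in> {0..T}" for t
    proof -
      have "\<bar>integral {0..t} (\<lambda>x. q x * Y (Suc n) x)\<bar> \<le> (M * (1/2)^Suc n) / L * exp (L * t)"
      proof (rule integral_exp_bound)
        show "continuous_on {0..t} (\<lambda>x. q x * Y (Suc n) x)"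
          using that by (intro continuous_on_mult continuous_on_subset[OF q] continuous_on_subset[OF cYS]) auto
        fix x assume "x \<in> {0..t}"
        then show "\<bar>q x * Y (Suc n) x\<bar> \<le> M * (1/2)^Suc n * exp (L * x)"
          using M YSb[of x] that by (auto simp: abs_mult mult.assoc intro!: mult_mono)
      qed (use L M that in auto)
      then show ?thesis by (simp add: V_def)
    qed
    then show ?case using dV dY cYS YSb by blast
  qed
  have geo: "summable (\<lambda>n. C * (1/2::real)^n)" for C
    by (intro summable_mult summable_geometric) auto
  define E where "E = exp (L * T)"
  have E: "exp (L * t) \<le> E" "0 < E" if "t \<in> {0..T}" for t
    using that L by (auto simp: E_def)
  have E1: "1 \<le> E" using L \<open>0 \<le> T\<close> by (simp add: E_def)
  have Yb: "\<bar>Y n t\<bar> \<le> E * (1/2)^n" if "t \<in> {0..T}" for n t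
  proof -
    have "\<bar>Y n t\<bar> \<le> (1/2)^n * exp (L * t)" using main[of n] that by blast
    also have "\<dots> \<le> (1/2)^n * E" by (intro mult_left_mono E that) auto
    finally show ?thesis by (simp only: mult.commute)
  qed
  \<comment> \<open>The summand 1 covers \<open>V 0 = 1\<close>, and the factor 2 the index shift in
    the bound from \<open>main\<close>.\<close>
  have Vb: "\<bar>V n t\<bar> \<le> (2 * M / L + 1) * E * (1/2)^n" if t: "t \<in> {0..T}" for n t
  proof (cases n)
    case 0
    have "1 * 1 \<le> (2 * M / L + 1) * E"
      using M L E1 by (intro mult_mono) auto
    then show ?thesis using 0 by (simp add: V_def)
  next
    case (Suc k)
    have "\<bar>V n t\<bar> \<le> M / L * (1/2)^k * exp (L * t)"
      using main[of k] t Suc by auto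
    also have "\<dots> \<le> M / L * (1/2)^k * E"
      using E[OF t] M L by (intro mult_left_mono) auto
    also have "\<dots> \<le> (M / L + 1/2) * (1/2)^k * E"
      using E[OF t] by (intro mult_right_mono) auto
    also have "\<dots> = (2 * M / L + 1) * E * (1/2)^n"
      using Suc by (simp add: algebra_simps)
    finally show ?thesis .
  qed
  have Ab: "\<bar>A n t\<bar> \<le> 2 * M * E * (1/2)^n" if t: "t \<in> {0..T}" for n t
  proof (cases n)
    case 0
    then show ?thesis using M E[OF t] by (simp add: A_def)
  next
    case (Suc k)
    have "\<bar>A n t\<bar> \<le> M * (E * (1/2)^k)"
      using Suc M(2)[OF t] M(1) Yb[OF t, of k] by (auto simp: A_def abs_mult intro!: mult_mono)
    then show ?thesis using Suc by simp
  qed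
  have 0: "0 \<in> {0..T}" using \<open>0 \<le> T\<close> by simp
  \<comment> \<open>Uniform convergence of both derivative series permits termwise differentiation
    of the sums of \<open>Y n\<close> and of \<open>V n\<close>.\<close>
  have uV: "uniform_limit {0..T} (\<lambda>n x. \<Sum>i<n. V i x) (\<lambda>x. \<Sum>i. V i x) sequentially"
    by (rule Weierstrass_m_test[OF _ geo]) (use Vb in auto)
  have uA: "uniform_limit {0..T} (\<lambda>n x. \<Sum>i<n. A i x) (\<lambda>x. \<Sum>i. A i x) sequentially"
    by (rule Weierstrass_m_test[OF _ geo]) (use Ab in auto)
  have sY: "summable (\<lambda>n. Y n t)" if "t \<in> {0..T}" for t
    by (rule summable_comparison_test'[OF geo]) (use Yb[OF that] in auto)
  have sV: "summable (\<lambda>n. V n t)" if "t \<in> {0..T}" for t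
    by (rule summable_comparison_test'[OF geo]) (use Vb[OF that] in auto)
  obtain y where y: "\<forall>x\<in>{0..T}. (\<lambda>n. Y n x) sums y x \<and>
      (y has_real_derivative (\<Sum>i. V i x)) (at x within {0..T})"
    using has_field_derivative_series[where f=Y and f'=V, OF _ _ uV 0 sY[OF 0]] main by auto
  obtain v where v: "\<forall>x\<in>{0..T}. (\<lambda>n. V n x) sums v x \<and>
      (v has_real_derivative (\<Sum>i. A i x)) (at x within {0..T})"
    using has_field_derivative_series[where f=V and f'=A, OF _ _ uA 0 sV[OF 0]] main by auto
  have "(\<Sum>i. A i t) = - (q t * y t)" if t: "t \<in> {0..T}" for t
  proof -
    have "(\<lambda>n. A (Suc n) t) sums (- (q t * y t))"
      unfolding A_def nat.case using y t by (intro sums_minus sums_mult) auto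
    then have "(\<lambda>n. A n t) sums (- (q t * y t) + A 0 t)"
      by (rule sums_Suc)
    then show ?thesis by (simp add: sums_iff A_def)
  qed
  moreover have "Y n 0 = 0" "V (Suc n) 0 = 0" for n
    by (cases n) (simp_all add: Y_def V_def)
  then have "y 0 = 0" "v 0 = 1"
  proof -
    have "(\<lambda>n. Y n 0) sums y 0" using y 0 by blast
    then show "y 0 = 0" using \<open>\<And>n. Y n 0 = 0\<close> by (simp add: sums_iff)
    have "(\<lambda>n. V (Suc n) 0) sums 0" using \<open>\<And>n. V (Suc n) 0 = 0\<close> by simp
    then have "(\<lambda>n. V n 0) sums (0 + V 0 0)" by (rule sums_Suc)
    moreover have "(\<lambda>n. V n 0) sums v 0" using v 0 by blast
    ultimately have "v 0 = 0 + V 0 0" by (rule sums_unique2[symmetric])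
    then show "v 0 = 1" by (simp add: V_def)
  qed
  moreover have "(\<Sum>i. V i t) = v t" if "t \<in> {0..T}" for t
    using v that sums_unique[of "\<lambda>i. V i t" "v t"] by simp
  ultimately have "jacobi T q y v"
    unfolding jacobi_def using y v by auto
  then show ?thesis by blast
qed

section \<open>Sturm comparison\<close>

lemma jacobi_deriv:
  assumes "jacobi T q y v" "0 < t" "t < T"
  shows "(y has_real_derivative v t) (at t)" "(v has_real_derivative - (q t * y t)) (at t)"
  using assms at_within_Icc_at[of 0 t T] unfolding jacobi_def by (auto dest!: bspec[of _ _ t])

text \<open>The slope 1 at 0 keeps \<open>y\<close> positive on a short interval after 0, so the
  first zero can be sought in a compact interval away from 0.\<close>

lemma jacobi_first_zero:
  assumes J: "jacobi T q y v" and "b \<le> T" and npos: "\<not> (\<forall>t\<in>{0<..<b}. 0 < y t)"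
  obtains \<tau> where "0 < \<tau>" "\<tau> < b" "y \<tau> = 0" "\<And>t. 0 < t \<Longrightarrow> t < \<tau> \<Longrightarrow> 0 < y t"
proof -
  obtain c where c: "0 < c" "c < b" "y c \<le> 0"
    using npos by (auto simp: not_less)
  have cont: "continuous_on {0..T} y" by (rule jacobi_continuous[OF J])
  have "(y has_real_derivative 1) (at 0 within {0..T})"
    using J c \<open>b \<le> T\<close> unfolding jacobi_def by force
  then obtain d where d: "0 < d" "\<And>h. 0 < h \<Longrightarrow> h \<in> {0..T} \<Longrightarrow> h < d \<Longrightarrow> 0 < y h"
    using has_real_derivative_pos_inc_right[of y 1 0 "{0..T}"] J unfolding jacobi_def by auto
  have dc: "d \<le> c"
    using d(2)[of c] c \<open>b \<le> T\<close> by force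
  \<comment> \<open>Taking \<open>y \<le> 0\<close> instead of \<open>y = 0\<close> puts
    \<open>c\<close> into \<open>Z\<close> at once; at the least element, continuity from the left
    supplies the other inequality.\<close>
  define Z where "Z = {d/2..c} \<inter> y -` {..0}"
  have "continuous_on {d/2..c} y"
    using cont by (rule continuous_on_subset) (use c d \<open>b \<le> T\<close> in auto)
  then have "closed Z"
    unfolding Z_def by (intro continuous_closed_preimage) auto
  moreover have "bounded Z"
    by (rule bounded_subset[of "{d/2..c}"]) (auto simp: Z_def)
  ultimately have "compact Z" by (simp add: compact_eq_bounded_closed)
  moreover have "c \<in> Z" using c d dc by (simp add: Z_def)
  then have "Z \<noteq> {}" by blast
  ultimately obtain \<tau> where \<tau>: "\<tau> \<in> Z" "\<And>t. t \<in> Z \<Longrightarrow> \<tau> \<le> t"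
    using compact_attains_inf by metis
  have \<tau>': "d/2 \<le> \<tau>" "\<tau> \<le> c" "y \<tau> \<le> 0" using \<tau> by (auto simp: Z_def)
  have pos: "0 < y t" if "0 < t" "t < \<tau>" for t
  proof (cases "t < d")
    case True
    then show ?thesis using d(2)[of t] that \<tau>' c \<open>b \<le> T\<close> by auto
  next
    case False
    then have "t \<notin> Z" using \<tau>(2)[of t] that by auto
    then show ?thesis using False that \<tau>' d by (auto simp: Z_def)
  qed
  have "0 \<le> y \<tau>"
  proof (rule continuous_ge_on_closure[of "{0<..<\<tau>}" y])
    show "continuous_on (closure {0<..<\<tau>}) y"
      using d c \<tau>' \<open>b \<le> T\<close> by (auto intro!: continuous_on_subset[OF cont])
  qed (use d \<tau>' pos in \<open>auto intro: less_imp_le\<close>)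
  then show thesis
    using that[of \<tau>] pos \<tau>' c d by simp
qed

text \<open>A positive slope at \<open>\<tau>\<close> would make \<open>y\<close> negative just
  before it. This fixes the sign of Wronskian boundary terms at a first zero.\<close>

lemma jacobi_deriv_first_zero:
  assumes J: "jacobi T q y v" and \<tau>: "0 < \<tau>" "\<tau> \<le> T" "y \<tau> = 0"
    and pos: "\<And>t. 0 < t \<Longrightarrow> t < \<tau> \<Longrightarrow> 0 < y t"
  shows "v \<tau> \<le> 0"
proof (rule ccontr)
  assume "\<not> v \<tau> \<le> 0"
  moreover have "(y has_real_derivative v \<tau>) (at \<tau> within {0..T})"
    using J \<tau> unfolding jacobi_def by auto
  ultimately obtain d where d: "0 < d"
    "\<And>h. 0 < h \<Longrightarrow> \<tau> - h \<in> {0..T} \<Longrightarrow> h < d \<Longrightarrow> y (\<tau> - h) < y \<tau>"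
    using has_real_derivative_pos_inc_left[of y "v \<tau>" \<tau> "{0..T}"] by auto
  define h where "h = min (d/2) (\<tau>/2)"
  have "0 < h" "h < d" "h < \<tau>" using d(1) \<tau>(1) by (auto simp: h_def)
  then show False
    using d(2)[of h] \<tau> pos[of "\<tau> - h"] by auto
qed

lemma jacobi_nonneg:
  assumes J: "jacobi T q y v" and pos: "\<And>t. 0 < t \<Longrightarrow> t < b \<Longrightarrow> 0 < y t" and "b \<le> T" "t \<in> {0..b}"
  shows "0 \<le> y t"
proof (cases "b = 0")
  case True
  then show ?thesis using assms unfolding jacobi_def by auto
next
  case False
  then have "0 < b" using assms by auto
  show ?thesis
  proof (rule continuous_ge_on_closure[of "{0<..<b}" y])
    show "continuous_on (closure {0<..<b}) y"
      using \<open>0 < b\<close> \<open>b \<le> T\<close> by (auto intro!: continuous_on_subset[OF jacobi_continuous(1)[OF J]])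
  qed (use assms \<open>0 < b\<close> in \<open>auto intro: less_imp_le\<close>)
qed

text \<open>The Wronskian \<open>w * y - u * v\<close> vanishes at 0 and has derivative
  \<open>(q - p) * u * y \<ge> 0\<close>, so \<open>u / y\<close> is nondecreasing; near 0 this
  quotient is close to 1 because both slopes are 1.\<close>

lemma sturm_quotient:
  assumes U: "jacobi T p u w" and Y: "jacobi T q y v" and "b \<le> T"
    and le: "\<And>t. t \<in> {0..T} \<Longrightarrow> p t \<le> q t"
    and u: "\<And>t. 0 < t \<Longrightarrow> t < b \<Longrightarrow> 0 < u t"
    and y: "\<And>t. 0 < t \<Longrightarrow> t < b \<Longrightarrow> 0 < y t"
    and t: "t \<in> {0..b}"
  shows "y t \<le> u t"
proof -
  have wr: "0 \<le> w t * y t - u t * v t" if "0 < t" "t < b" for t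
  proof -
    let ?E = "\<lambda>t. w t * y t - u t * v t"
    have "\<exists>x\<in>{0..t}. ?E t - ?E 0 = (\<lambda>h. h * ((q x - p x) * (u x * y x))) (t - 0)"
    proof (rule mvt_very_simple)
      fix x assume "0 \<le> x" "x \<le> t"
      then have x: "x \<in> {0..T}" using that \<open>b \<le> T\<close> by auto
      have d: "(y has_real_derivative v x) (at x within {0..T})"
        "(v has_real_derivative - (q x * y x)) (at x within {0..T})"
        "(u has_real_derivative w x) (at x within {0..T})"
        "(w has_real_derivative - (p x * u x)) (at x within {0..T})"
        using U Y x unfolding jacobi_def by auto
      have "(?E has_real_derivative (q x - p x) * (u x * y x)) (at x within {0..T})"
        by (auto intro!: derivative_eq_intros d simp: algebra_simps)
      then have "(?E has_real_derivative (q x - p x) * (u x * y x)) (at x within {0..t})"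
        by (rule DERIV_subset) (use that \<open>b \<le> T\<close> in auto)
      then show "(?E has_derivative (\<lambda>h. h * ((q x - p x) * (u x * y x)))) (at x within {0..t})"
        by (simp add: has_field_derivative_def mult.commute[of _ "(q x - p x) * (u x * y x)"])
    qed (use that in auto)
    then obtain x where x: "x \<in> {0..t}" "?E t - ?E 0 = t * ((q x - p x) * (u x * y x))"
      by auto
    have "0 \<le> u x" "0 \<le> y x"
      using x(1) that jacobi_nonneg[OF U u \<open>b \<le> T\<close>] jacobi_nonneg[OF Y y \<open>b \<le> T\<close>] by auto
    then have "0 \<le> t * ((q x - p x) * (u x * y x))"
      using le[of x] x(1) that \<open>b \<le> T\<close> by auto
    then have "?E 0 \<le> ?E t" using x(2) by linarith
    then show ?thesis using U Y unfolding jacobi_def by simp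
  qed
  have inner: "y t \<le> u t" if t: "0 < t" "t < b" for t
  proof (rule ccontr)
    assume "\<not> y t \<le> u t"
    \<comment> \<open>This replaces the limit of \<open>u / y\<close> at 0. Monotonicity gives
      \<open>u \<le> r * y\<close> up to \<open>t\<close>, while \<open>r * y - u\<close> vanishes
      at 0 with slope \<open>r - 1 < 0\<close> and so is negative just after 0.\<close>
    define r where "r = u t / y t"
    have r: "r < 1" using \<open>\<not> y t \<le> u t\<close> y[OF t] by (simp add: r_def)
    have le_r: "u x \<le> r * y x" if x: "0 < x" "x \<le> t" for x
    proof -
      have "u x / y x \<le> u t / y t"
      proof (rule DERIV_nonneg_imp_nondecreasing[OF x(2)])
        fix z assume z: "x \<le> z" "z \<le> t"
        then have z': "0 < z" "z < T" "z < b" using x t \<open>b \<le> T\<close> by auto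
        note * = jacobi_deriv[OF U z'(1,2)] jacobi_deriv[OF Y z'(1,2)]
        have "((\<lambda>z. u z / y z) has_real_derivative (w z * y z - u z * v z) / (y z * y z)) (at z)"
          using y[OF z'(1,3)] by (auto intro!: derivative_eq_intros * )
        then show "\<exists>D. ((\<lambda>z. u z / y z) has_real_derivative D) (at z) \<and> 0 \<le> D"
          using wr[OF z'(1,3)] by (intro exI conjI) auto
      qed
      then show ?thesis
        using y[of x] x t by (simp add: r_def divide_le_eq)
    qed
    have drv: "((\<lambda>x. r * y x - u x) has_real_derivative (r * v 0 - w 0)) (at 0 within {0..T})"
      using U Y t \<open>b \<le> T\<close> unfolding jacobi_def by (auto intro!: derivative_eq_intros)
    have neg: "r * v 0 - w 0 < 0" using U Y r unfolding jacobi_def by simp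
    obtain d where d: "0 < d"
      "\<And>h. 0 < h \<Longrightarrow> h \<in> {0..T} \<Longrightarrow> h < d \<Longrightarrow> r * y h - u h < r * y 0 - u 0"
      using has_real_derivative_neg_dec_right[OF drv neg] by auto
    define h where "h = min (d/2) t"
    have "r * y h - u h < 0"
      using d(2)[of h] d(1) t \<open>b \<le> T\<close> U Y unfolding jacobi_def h_def by (simp add: min_less_iff_disj)
    moreover have "0 < h" "h \<le> t" using d t by (auto simp: h_def)
    ultimately show False using le_r[of h] by linarith
  qed
  have "0 \<le> (\<lambda>t. u t - y t) t"
  proof (cases "b = 0")
    case True
    then show ?thesis using U Y t unfolding jacobi_def by auto
  next
    case False
    then have "0 < b" using t by auto
    show ?thesis
    proof (rule continuous_ge_on_closure[of "{0<..<b}" "\<lambda>t. u t - y t"])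
      show "continuous_on (closure {0<..<b}) (\<lambda>t. u t - y t)"
        using \<open>0 < b\<close> \<open>b \<le> T\<close> jacobi_continuous(1)[OF U] jacobi_continuous(1)[OF Y]
        by (auto intro!: continuous_intros intro: continuous_on_subset)
    qed (use inner t \<open>0 < b\<close> in auto)
  qed
  then show ?thesis by simp
qed

text \<open>At a first zero \<open>\<tau> < b\<close> of \<open>u\<close>, the quotient argument on
  \<open>{0..\<tau>}\<close> would give \<open>y \<tau> \<le> 0\<close>; hence \<open>u\<close>
  stays positive and the argument applies up to \<open>b\<close>.\<close>

lemma sturm_comparison:
  assumes U: "jacobi T p u w" and Y: "jacobi T q y v" and "b \<le> T"
    and le: "\<And>t. t \<in> {0..T} \<Longrightarrow> p t \<le> q t"
    and y: "\<And>t. 0 < t \<Longrightarrow> t < b \<Longrightarrow> 0 < y t"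
  shows sturm_pos: "\<And>t. 0 < t \<Longrightarrow> t < b \<Longrightarrow> 0 < u t"
    and sturm_le: "\<And>t. t \<in> {0..b} \<Longrightarrow> y t \<le> u t"
proof -
  have "\<forall>t\<in>{0<..<b}. 0 < u t"
  proof (rule ccontr)
    assume "\<not> ?thesis"
    then obtain \<tau> where \<tau>: "0 < \<tau>" "\<tau> < b" "u \<tau> = 0" "\<And>t. 0 < t \<Longrightarrow> t < \<tau> \<Longrightarrow> 0 < u t"
      using jacobi_first_zero[OF U \<open>b \<le> T\<close>] by metis
    have "y \<tau> \<le> u \<tau>"
      by (rule sturm_quotient[OF U Y, of \<tau>]) (use \<tau> le y \<open>b \<le> T\<close> in auto)
    then show False using y[of \<tau>] \<tau> by simp
  qed
  then show pos: "\<And>t. 0 < t \<Longrightarrow> t < b \<Longrightarrow> 0 < u t" by simp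
  show "\<And>t. t \<in> {0..b} \<Longrightarrow> y t \<le> u t"
    by (rule sturm_quotient[OF U Y \<open>b \<le> T\<close> le pos y]) auto
qed

section \<open>Stopped values at the final time\<close>

text \<open>The solution starts upwards, so without an earlier zero it is positive. A zero at
  \<open>T\<close> itself needs no separate case, since then \<open>y T = 0\<close> anyway.\<close>

lemma stopped_cases:
  assumes J: "jacobi T q y v" and "0 < T"
  shows "stopped {0..T} y T = (if \<forall>t\<in>{0<..<T}. 0 < y t then y T else 0)"
proof (cases "\<forall>t\<in>{0<..<T}. 0 < y t")
  case True
  then have "\<not> (\<exists>\<tau>. first_positive_zero {0..T} y \<tau> \<and> \<tau> < T)"
    unfolding first_positive_zero_def by (metis greaterThanLessThan_iff less_irrefl)
  then have "stopped {0..T} y T = y T" unfolding stopped_def by (rule if_not_P)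
  then show ?thesis using if_P[OF True] by metis
next
  case False
  then obtain \<tau> where \<tau>: "0 < \<tau>" "\<tau> < T" "y \<tau> = 0" "\<And>t. 0 < t \<Longrightarrow> t < \<tau> \<Longrightarrow> 0 < y t"
    using jacobi_first_zero[OF J order_refl] by metis
  then have "first_positive_zero {0..T} y \<tau>"
    by (auto simp: first_positive_zero_def less_imp_neq[symmetric])
  then have "stopped {0..T} y T = 0" using \<tau>(2) unfolding stopped_def by auto
  then show ?thesis using if_not_P[OF False] by metis
qed

lemma stopped_nonneg:
  assumes J: "jacobi T q y v" and "0 < T"
  shows "0 \<le> stopped {0..T} y T"
  using stopped_cases[OF assms] jacobi_nonneg[OF J, of T T] \<open>0 < T\<close> by auto

lemma stopped_antimono:
  assumes U: "jacobi T p u w" and Y: "jacobi T q y v" and "0 < T"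
    and le: "\<And>t. t \<in> {0..T} \<Longrightarrow> p t \<le> q t"
  shows "stopped {0..T} y T \<le> stopped {0..T} u T"
proof (cases "\<forall>t\<in>{0<..<T}. 0 < y t")
  case True
  then have "\<forall>t\<in>{0<..<T}. 0 < u t" "y T \<le> u T"
    using sturm_comparison[OF U Y order_refl le] \<open>0 < T\<close> by auto
  then show ?thesis
    using True by (simp add: stopped_cases[OF U \<open>0 < T\<close>] stopped_cases[OF Y \<open>0 < T\<close>])
next
  case False
  then have "stopped {0..T} y T = 0" using stopped_cases[OF Y \<open>0 < T\<close>] if_not_P[OF False] by metis
  then show ?thesis using stopped_nonneg[OF U \<open>0 < T\<close>] by simp
qed

text \<open>The derivative of the Wronskian of \<open>y\<close> and the time reversal of \<open>r\<close>, integrated over \<open>{c..T}\<close>.\<close>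
lemma wronskian_integral:
  assumes Y: "jacobi T p y v" and R: "jacobi T (\<lambda>t. q (T - t)) r w" and c: "c \<in> {0..T}"
  shows "((\<lambda>t. (q t - p t) * (y t * r (T - t))) has_integral
           (y T - (y c * w (T - c) + v c * r (T - c)))) {c..T}"
proof -
  \<comment> \<open>Reversing time flips the sign of the derivative of \<open>r\<close>, hence the
    plus sign. The data of \<open>r\<close> at 0 give \<open>E T = y T\<close>.\<close>
  define E where "E t = y t * w (T - t) + v t * r (T - t)" for t
  have "((\<lambda>t. (q t - p t) * (y t * r (T - t))) has_integral (E T - E c)) {c..T}"
  proof (rule fundamental_theorem_of_calculus)
    fix t assume "t \<in> {c..T}"
    then have t: "t \<in> {0..T}" "T - t \<in> {0..T}" using c by auto
    have img: "(\<lambda>t. T - t) ` {0..T} = {0..T}"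
      by (auto simp: image_iff intro!: bexI[of _ "T - _"])
    have refl: "((\<lambda>t. T - t) has_real_derivative -1) (at t within {0..T})"
      by (auto intro!: derivative_eq_intros)
    have r: "((\<lambda>t. r (T - t)) has_real_derivative - w (T - t)) (at t within {0..T})"
      using DERIV_image_chain[OF _ refl, of r "w (T - t)"] R t(2)
      unfolding img jacobi_def o_def by simp
    have w: "((\<lambda>t. w (T - t)) has_real_derivative q t * r (T - t)) (at t within {0..T})"
      using DERIV_image_chain[OF _ refl, of w "- (q t * r (T - t))"] bspec[OF conjunct2[OF conjunct2[OF conjunct2[OF R[unfolded jacobi_def]]]] t(2)]
      unfolding img o_def by simp
    have y: "(y has_real_derivative v t) (at t within {0..T})"
      "(v has_real_derivative - (p t * y t)) (at t within {0..T})"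
      using Y t(1) unfolding jacobi_def by auto
    have "(E has_real_derivative (q t - p t) * (y t * r (T - t))) (at t within {0..T})"
      unfolding E_def by (auto intro!: derivative_eq_intros r w y simp: algebra_simps)
    then have "(E has_real_derivative (q t - p t) * (y t * r (T - t))) (at t within {c..T})"
      by (rule DERIV_subset) (use c in auto)
    then show "(E has_vector_derivative (q t - p t) * (y t * r (T - t))) (at t within {c..T})"
      by (simp add: has_real_derivative_iff_has_vector_derivative)
  qed (use c in auto)
  moreover have "E T = y T" using R unfolding jacobi_def E_def by simp
  ultimately show ?thesis by (simp add: E_def)
qed

section \<open>Dependence on the potential\<close>

text \<open>Pairing \<open>y1\<close> with the solution \<open>r\<close> for \<open>q2\<close> run
  backwards from \<open>T\<close> expresses the finite difference exactly, as an integral of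
  \<open>(q2 - q1) * y1 * r\<close> up to a boundary term. Sturm comparison bounds both factors by
  \<open>s\<close>, and the boundary term is at most the stopped value of \<open>y2\<close>.\<close>

lemma stopped_diff_le:
  assumes Y1: "jacobi T q1 y1 v1" and Y2: "jacobi T q2 y2 v2" and S: "jacobi T (\<lambda>_. l) s w"
    and "0 < T" and cont: "continuous_on {0..T} q1" "continuous_on {0..T} q2"
    and l: "\<And>t. t \<in> {0..T} \<Longrightarrow> l \<le> q1 t" and le: "\<And>t. t \<in> {0..T} \<Longrightarrow> q1 t \<le> q2 t"
    and spos: "\<And>t. 0 < t \<Longrightarrow> t < T \<Longrightarrow> 0 < s t"
  shows "stopped {0..T} y1 T - stopped {0..T} y2 T
    \<le> integral {0..T} (\<lambda>t. (q2 t - q1 t) * (s t * s (T - t)))"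
proof -
  have s0: "0 \<le> s t" if "t \<in> {0..T}" for t
    by (rule jacobi_nonneg[OF S spos order_refl that])
  have cs: "continuous_on {0..T} s" by (rule jacobi_continuous[OF S])
  have cs': "continuous_on {0..T} (\<lambda>t. s (T - t))"
    by (rule continuous_on_compose2[OF cs]) (auto intro!: continuous_intros)
  let ?g = "\<lambda>t. (q2 t - q1 t) * (s t * s (T - t))"
  have gc: "continuous_on {0..T} ?g"
    by (intro continuous_intros cont cs cs')
  have g0: "0 \<le> ?g t" if "t \<in> {0..T}" for t
    using that le[OF that] s0[of t] s0[of "T - t"] by auto
  have I0: "0 \<le> integral {0..T} ?g"
    by (rule integral_nonneg[OF integrable_continuous_real[OF gc] g0])
  have Y2nn: "0 \<le> stopped {0..T} y2 T" by (rule stopped_nonneg[OF Y2 \<open>0 < T\<close>])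
  show ?thesis
  proof (cases "\<forall>t\<in>{0<..<T}. 0 < y1 t")
    case False
    then have "stopped {0..T} y1 T = 0" using stopped_cases[OF Y1 \<open>0 < T\<close>] if_not_P[OF False] by metis
    then show ?thesis using I0 Y2nn by linarith
  next
    case True
    then have st1: "stopped {0..T} y1 T = y1 T" using stopped_cases[OF Y1 \<open>0 < T\<close>] if_P[OF True] by metis
    have y1pos: "\<And>t. 0 < t \<Longrightarrow> t < T \<Longrightarrow> 0 < y1 t" using True by simp
    have y1s: "y1 t \<le> s t" if "t \<in> {0..T}" for t
      by (rule sturm_le[OF S Y1 order_refl l y1pos that])
    have y1nn: "0 \<le> y1 t" if "t \<in> {0..T}" for t
      by (rule jacobi_nonneg[OF Y1 y1pos order_refl that])
    have "continuous_on {0..T} (\<lambda>t. q2 (T - t))"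
      by (rule continuous_on_compose2[OF cont(2)]) (auto intro!: continuous_intros)
    then obtain r x where R: "jacobi T (\<lambda>t. q2 (T - t)) r x"
      using jacobi_exists \<open>0 < T\<close> by (meson less_imp_le)
    \<comment> \<open>Past its first zero \<open>r\<close> may change sign, so the pairing is
      confined to the last \<open>\<rho>\<close> units of time; \<open>\<rho> = T\<close> if there
      is no earlier zero.\<close>
    obtain \<rho> where \<rho>: "0 < \<rho>" "\<rho> \<le> T" "\<And>t. 0 < t \<Longrightarrow> t < \<rho> \<Longrightarrow> 0 < r t" "\<rho> = T \<or> r \<rho> = 0"
    proof (cases "\<forall>t\<in>{0<..<T}. 0 < r t")
      case True
      then show thesis using that[of T] \<open>0 < T\<close> by simp
    next
      case False
      then obtain \<tau> where "0 < \<tau>" "\<tau> < T" "r \<tau> = 0" "\<And>t. 0 < t \<Longrightarrow> t < \<tau> \<Longrightarrow> 0 < r t"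
        using jacobi_first_zero[OF R order_refl] by metis
      then show thesis using that[of \<tau>] by simp
    qed
    define c where "c = T - \<rho>"
    have c: "c \<in> {0..T}" "T - c = \<rho>" using \<rho> by (auto simp: c_def)
    have l2: "l \<le> q2 (T - t)" if "t \<in> {0..T}" for t
      using l[of "T - t"] le[of "T - t"] that by simp
    have rs: "r t \<le> s t" if "t \<in> {0..\<rho>}" for t
      by (rule sturm_le[OF S R \<rho>(2) l2 \<rho>(3) that]) auto
    have rnn: "0 \<le> r t" if "t \<in> {0..\<rho>}" for t
      by (rule jacobi_nonneg[OF R \<rho>(3) \<rho>(2) that])
    have hi: "((\<lambda>t. (q2 t - q1 t) * (y1 t * r (T - t))) has_integral
           (y1 T - (y1 c * x \<rho> + v1 c * r \<rho>))) {c..T}"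
      using wronskian_integral[OF Y1 R c(1)] by (simp add: c)
    have "y1 T - (y1 c * x \<rho> + v1 c * r \<rho>) \<le> integral {c..T} ?g"
    proof (rule has_integral_le[OF hi])
      show "(?g has_integral integral {c..T} ?g) {c..T}"
        by (intro integrable_integral integrable_continuous_real continuous_on_subset[OF gc]) (use c in auto)
      fix t assume t: "t \<in> {c..T}"
      then have t': "t \<in> {0..T}" "T - t \<in> {0..\<rho>}" using c by auto
      show "(q2 t - q1 t) * (y1 t * r (T - t)) \<le> ?g t"
        using le[OF t'(1)] y1s[OF t'(1)] y1nn[OF t'(1)] rs[OF t'(2)] rnn[OF t'(2)] s0[OF t'(1)]
        by (intro mult_left_mono mult_mono) auto
    qed
    also have "\<dots> \<le> integral {0..T} ?g"
      by (rule integral_subset_le) (use c g0 in \<open>auto intro!: integrable_continuous_real continuous_on_subset[OF gc]\<close>)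
    finally have main: "y1 T - (y1 c * x \<rho> + v1 c * r \<rho>) \<le> integral {0..T} ?g" .
    \<comment> \<open>If \<open>r \<rho> = 0\<close>, then \<open>x \<rho> \<le> 0\<close> makes the
      boundary term nonpositive. Otherwise \<open>c = 0\<close> and the term is \<open>r T\<close>,
      which has to be identified with \<open>y2 T\<close>.\<close>
    have "y1 c * x \<rho> + v1 c * r \<rho> \<le> stopped {0..T} y2 T"
    proof (cases "r \<rho> = 0")
      case True
      have "x \<rho> \<le> 0"
        by (rule jacobi_deriv_first_zero[OF R \<rho>(1,2) True \<rho>(3)])
      then have "y1 c * x \<rho> \<le> 0" using y1nn[OF c(1)] by (rule mult_nonneg_nonpos[rotated])
      then show ?thesis using True Y2nn by simp
    next
      case False
      then have "\<rho> = T" "c = 0" using \<rho>(4) c by auto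
      then have eq: "y1 c * x \<rho> + v1 c * r \<rho> = r T"
        using Y1 unfolding jacobi_def by simp
      have rpos: "0 < r T" using False rnn[of \<rho>] \<rho> \<open>\<rho> = T\<close> by auto
      \<comment> \<open>Both solutions now belong to \<open>q2\<close>, so their Wronskian is
        constant. At a first zero of \<open>y2\<close> it would be nonpositive, contradicting
        \<open>0 < r T\<close>; at \<open>T\<close> it equals \<open>y2 T\<close>.\<close>
      have W: "r T = y2 b * x (T - b) + v2 b * r (T - b)" if "b \<in> {0..T}" for b
      proof -
        have "y2 T - (y2 b * x (T - b) + v2 b * r (T - b)) = 0" if "b \<in> {0..T}" for b
          using wronskian_integral[OF Y2 R that] by (simp add: has_integral_0_eq)
        from this[of b] this[of 0] that \<open>0 < T\<close> Y2 show ?thesis unfolding jacobi_def by simp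
      qed
      have "\<forall>t\<in>{0<..<T}. 0 < y2 t"
      proof (rule ccontr)
        assume "\<not> ?thesis"
        then obtain \<sigma> where \<sigma>: "0 < \<sigma>" "\<sigma> < T" "y2 \<sigma> = 0" "\<And>t. 0 < t \<Longrightarrow> t < \<sigma> \<Longrightarrow> 0 < y2 t"
          using jacobi_first_zero[OF Y2 order_refl] by metis
        have "v2 \<sigma> \<le> 0"
          by (rule jacobi_deriv_first_zero[OF Y2 \<sigma>(1) less_imp_le[OF \<sigma>(2)] \<sigma>(3,4)])
        then have "v2 \<sigma> * r (T - \<sigma>) \<le> 0"
          using rnn[of "T - \<sigma>"] \<sigma> \<open>\<rho> = T\<close> by (intro mult_nonpos_nonneg) auto
        then show False using W[of \<sigma>] \<sigma> rpos by auto
      qed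
      then have "stopped {0..T} y2 T = y2 T"
        using stopped_cases[OF Y2 \<open>0 < T\<close>] if_P by metis
      moreover have "y2 T = r T" using W[of T] R \<open>0 < T\<close> unfolding jacobi_def by simp
      ultimately show ?thesis using eq by simp
    qed
    then show ?thesis using main st1 by linarith
  qed
qed

text \<open>A constant potential is its own time reversal, so \<open>u T - s T\<close> is exactly
  \<open>h\<close> times the integral of \<open>u t * s (T - t)\<close>, and
  \<open>s \<le> u\<close>. Lowering the potential makes this a lower bound with the same weight as
  in \<open>stopped_diff_le\<close>.\<close>

lemma stopped_const_diff_ge:
  assumes U: "jacobi T (\<lambda>_. l - h) u w'" and S: "jacobi T (\<lambda>_. l) s w"
    and "0 < T" "0 \<le> h" and spos: "\<And>t. 0 < t \<Longrightarrow> t < T \<Longrightarrow> 0 < s t"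
  shows "h * integral {0..T} (\<lambda>t. s t * s (T - t)) \<le> stopped {0..T} u T - stopped {0..T} s T"
proof -
  have s0: "0 \<le> s t" if "t \<in> {0..T}" for t
    by (rule jacobi_nonneg[OF S spos order_refl that])
  have us: "s t \<le> u t" if "t \<in> {0..T}" for t
    by (rule sturm_le[OF U S order_refl _ spos that]) (use \<open>0 \<le> h\<close> in auto)
  have upos: "0 < u t" if "0 < t" "t < T" for t
    by (rule sturm_pos[OF U S order_refl _ spos that]) (use \<open>0 \<le> h\<close> in auto)
  have st: "stopped {0..T} u T = u T" "stopped {0..T} s T = s T"
    unfolding stopped_cases[OF U \<open>0 < T\<close>] stopped_cases[OF S \<open>0 < T\<close>] using upos spos by auto
  have cs: "continuous_on {0..T} s" by (rule jacobi_continuous[OF S])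
  have "continuous_on {0..T} (\<lambda>t. s (T - t))"
    by (rule continuous_on_compose2[OF cs]) (auto intro!: continuous_intros)
  then have "continuous_on {0..T} (\<lambda>t. s t * s (T - t))"
    by (intro continuous_intros cs)
  then have "((\<lambda>t. h * (s t * s (T - t))) has_integral h * integral {0..T} (\<lambda>t. s t * s (T - t))) {0..T}"
    by (intro has_integral_mult_right integrable_integral integrable_continuous_real)
  moreover have "((\<lambda>t. (l - (l - h)) * (u t * s (T - t))) has_integral (u T - (u 0 * w (T - 0) + w' 0 * s (T - 0)))) {0..T}"
    by (rule wronskian_integral[OF U S]) (use \<open>0 < T\<close> in auto)
  ultimately have "h * integral {0..T} (\<lambda>t. s t * s (T - t)) \<le> u T - (u 0 * w (T - 0) + w' 0 * s (T - 0))"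
    by (rule has_integral_le) (use us s0 \<open>0 \<le> h\<close> in \<open>auto intro!: mult_left_mono mult_right_mono\<close>)
  also have "\<dots> = u T - s T" using U unfolding jacobi_def by simp
  finally show ?thesis by (simp add: st)
qed

section \<open>Time averages along the flow\<close>

text \<open>Completeness makes continuous curves in this space integrable.\<close>

instance bcontfun :: (metric_space, banach) banach ..

text \<open>Fubini by integrating the curve \<open>t \<mapsto> g t\<close> in the Banach space of bounded continuous functions
  and exchanging that integral with bounded linear functionals; this avoids product measurability,
  which is awkward since \<open>'a\<close> is not of a second countable type class.\<close>
lemma integral_swap_compact_space:
  fixes m :: "'a::metric_space measure" and g :: "real \<Rightarrow> 'a \<Rightarrow> real"
  assumes "compact (UNIV :: 'a set)" and fin: "finite_measure m" and sets: "sets m = sets borel"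
    and g: "continuous_on ({a..b} \<times> UNIV) (\<lambda>(t, z). g t z)"
  shows "integrable m (\<lambda>z. integral {a..b} (\<lambda>t. g t z))"
    and "(\<integral>z. integral {a..b} (\<lambda>t. g t z) \<partial>m) = integral {a..b} (\<lambda>t. \<integral>z. g t z \<partial>m)"
proof -
  interpret finite_measure m by (rule fin)
  have gt: "continuous_on UNIV (g t)" if "t \<in> {a..b}" for t
    using continuous_on_compose2[OF g, of UNIV "\<lambda>z. (t, z)"] that by (force intro!: continuous_intros)
  define F where "F t = Bcontfun (g t)" for t
  have F: "apply_bcontfun (F t) = g t" if "t \<in> {a..b}" for t
    unfolding F_def
  proof (rule Bcontfun_inverse)
    show "g t \<in> bcontfun"
      using gt[OF that] compact_imp_bounded[OF compact_continuous_image[OF gt[OF that] assms(1)]]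
      by (simp add: bcontfun_def)
  qed
  have "continuous_on {a..b} F"
    unfolding continuous_on_def
  proof
    fix t0 assume t0: "t0 \<in> {a..b}"
    show "(F \<longlongrightarrow> F t0) (at t0 within {a..b})"
    proof (rule uniform_limit_tendsto_bcontfun, rule uniform_limitI)
      fix e :: real assume "0 < e"
      then have "0 < e/2" by simp
      \<comment> \<open>Compactness makes joint continuity uniform in \<open>z\<close>, which is
        continuity of \<open>F\<close> in the supremum norm.\<close>
      obtain X where X: "t0 \<in> X" "open X" "\<forall>t\<in>X \<inter> {a..b}. \<forall>z\<in>UNIV. dist (g t z) (g t0 z) \<le> e/2"
        using continuous_on_prod_compactE[OF g assms(1) t0 \<open>0 < e/2\<close>] unfolding case_prod_conv by metis
      have "\<forall>\<^sub>F t in at t0 within {a..b}. t \<in> X \<and> t \<in> {a..b}"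
        using X by (auto simp: eventually_at_topological)
      then show "\<forall>\<^sub>F t in at t0 within {a..b}. \<forall>z\<in>UNIV. dist (F t z) (F t0 z) < e"
      proof eventually_elim
        case (elim t)
        show ?case
        proof
          fix z
          have "dist (g t z) (g t0 z) \<le> e/2" using X elim by blast
          then show "dist (F t z) (F t0 z) < e" using elim t0 \<open>0 < e\<close> by (simp add: F)
        qed
      qed
    qed
  qed
  then have int: "(F has_integral integral {a..b} F) {a..b}"
    by (intro integrable_integral integrable_continuous_real)
  have meas: "apply_bcontfun f \<in> borel_measurable m" for f :: "'a \<Rightarrow>\<^sub>C real"
    using borel_measurable_continuous_onI[OF continuous_on_apply_bcontfun, of f]
    by (simp add: measurable_cong_sets[OF sets refl])
  have intg: "integrable m (apply_bcontfun f)" for f :: "'a \<Rightarrow>\<^sub>C real"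
    by (rule integrable_const_bound[of _ "norm f"]) (use norm_bounded[of f] meas in auto)
  have ev: "bounded_linear (\<lambda>f :: 'a \<Rightarrow>\<^sub>C real. apply_bcontfun f z)" for z
  proof (rule bounded_linear_intro[of _ 1])
    show "norm (apply_bcontfun f z) \<le> norm f * 1" for f :: "'a \<Rightarrow>\<^sub>C real"
      using norm_bounded[of f z] by simp
  qed auto
  have L: "bounded_linear (\<lambda>f :: 'a \<Rightarrow>\<^sub>C real. \<integral>z. apply_bcontfun f z \<partial>m)"
  proof (rule bounded_linear_intro[of _ "measure m (space m)"])
    fix f g :: "'a \<Rightarrow>\<^sub>C real" and c :: real
    show "(\<integral>z. (f + g) z \<partial>m) = (\<integral>z. f z \<partial>m) + (\<integral>z. g z \<partial>m)"
      using intg by simp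
    show "(\<integral>z. (c *\<^sub>R f) z \<partial>m) = c *\<^sub>R (\<integral>z. f z \<partial>m)"
      by simp
    have "norm (\<integral>z. f z \<partial>m) \<le> (\<integral>z. norm (f z) \<partial>m)" by (rule integral_norm_bound)
    also have "\<dots> \<le> (\<integral>z. norm f \<partial>m)"
      by (intro integral_mono integrable_norm intg) (simp_all add: norm_bounded del: real_norm_def)
    finally show "norm (\<integral>z. f z \<partial>m) \<le> norm f * measure m (space m)"
      by (simp add: mult.commute)
  qed
  have I: "integral {a..b} (\<lambda>t. g t z) = integral {a..b} F z" for z
  proof -
    have "integral {a..b} (\<lambda>t. g t z) = integral {a..b} ((\<lambda>f. apply_bcontfun f z) \<circ> F)"
      by (intro Henstock_Kurzweil_Integration.integral_cong) (simp add: F)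
    then show ?thesis using has_integral_linear[OF int ev, of z] by (simp add: integral_unique)
  qed
  show "integrable m (\<lambda>z. integral {a..b} (\<lambda>t. g t z))"
    unfolding I by (rule intg)
  have "(\<integral>z. integral {a..b} (\<lambda>t. g t z) \<partial>m) = integral {a..b} ((\<lambda>f. \<integral>z. apply_bcontfun f z \<partial>m) \<circ> F)"
    unfolding I using has_integral_linear[OF int L] by (simp add: integral_unique)
  also have "\<dots> = integral {a..b} (\<lambda>t. \<integral>z. g t z \<partial>m)"
    by (intro Henstock_Kurzweil_Integration.integral_cong) (simp add: F)
  finally show "(\<integral>z. integral {a..b} (\<lambda>t. g t z) \<partial>m) = integral {a..b} (\<lambda>t. \<integral>z. g t z \<partial>m)" .
qed

text \<open>Invariance on Borel sets says that the push-forward of \<open>m\<close> under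
  \<open>\<Phi> t\<close> is \<open>m\<close>; the rest is change of variables.\<close>

lemma measure_preserving_flow_integral:
  fixes m :: "'a::metric_space measure" and f :: "'a \<Rightarrow> real"
  assumes "finite_measure m" and sets: "sets m = sets borel"
    and flow: "measure_preserving_flow T m \<Phi>" and t: "t \<in> {0..T}" and f: "f \<in> borel_measurable borel"
  shows "(\<integral>z. f (\<Phi> t z) \<partial>m) = (\<integral>z. f z \<partial>m)"
proof -
  interpret finite_measure m by fact
  have cont: "continuous_on ({0..T} \<times> UNIV) (\<lambda>(t, z). \<Phi> t z)"
    using flow unfolding measure_preserving_flow_def by blast
  have "continuous_on UNIV (\<Phi> t)"
    using continuous_on_compose2[OF cont, of UNIV "\<lambda>z. (t, z)"] t by (force intro!: continuous_intros)
  then have meas: "\<Phi> t \<in> measurable m borel"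
    by (simp add: measurable_cong_sets[OF sets refl] borel_measurable_continuous_onI)
  have sp: "space m = UNIV" using sets_eq_imp_space_eq[OF sets] by simp
  have "distr m borel (\<Phi> t) = m"
  proof (rule measure_eqI)
    fix E assume "E \<in> sets (distr m borel (\<Phi> t))"
    then have E: "E \<in> sets borel" by simp
    have "measure m (\<Phi> t -` E) = measure m E"
      using flow t E unfolding measure_preserving_flow_def by blast
    then show "emeasure (distr m borel (\<Phi> t)) E = emeasure m E"
      using E meas by (simp add: emeasure_distr sp emeasure_eq_measure)
  qed (simp add: sets)
  then show ?thesis
    using integral_distr[OF meas f] by simp
qed

text \<open>After the swap every time slice contributes the same space integral of \<open>f\<close>,
  so the weight \<open>w\<close> factors out.\<close>

lemma measure_preserving_flow_time_integral:
  fixes m :: "'a::metric_space measure" and f :: "'a \<Rightarrow> real"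
  assumes "compact (UNIV :: 'a set)" and "finite_measure m" and "sets m = sets borel"
    and flow: "measure_preserving_flow T m \<Phi>"
    and f: "continuous_on UNIV f" and w: "continuous_on {0..T} w"
  shows "integrable m (\<lambda>z. integral {0..T} (\<lambda>t. f (\<Phi> t z) * w t))"
    and "(\<integral>z. integral {0..T} (\<lambda>t. f (\<Phi> t z) * w t) \<partial>m) = (\<integral>z. f z \<partial>m) * integral {0..T} w"
proof -
  have "continuous_on ({0..T} \<times> UNIV) (\<lambda>(t, z). \<Phi> t z)"
    using flow unfolding measure_preserving_flow_def by blast
  then have "continuous_on ({0..T} \<times> UNIV) (\<lambda>p. f (\<Phi> (fst p) (snd p)) * w (fst p))"
    by (intro continuous_intros continuous_on_compose2[OF f] continuous_on_compose2[OF w])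
      (auto simp: case_prod_beta')
  then have c: "continuous_on ({0..T} \<times> UNIV) (\<lambda>(t, z). f (\<Phi> t z) * w t)"
    by (simp add: case_prod_beta')
  note swap = integral_swap_compact_space[OF assms(1-3) c]
  show "integrable m (\<lambda>z. integral {0..T} (\<lambda>t. f (\<Phi> t z) * w t))" by (rule swap(1))
  have "(\<integral>z. integral {0..T} (\<lambda>t. f (\<Phi> t z) * w t) \<partial>m) = integral {0..T} (\<lambda>t. \<integral>z. f (\<Phi> t z) * w t \<partial>m)"
    by (rule swap(2))
  also have "\<dots> = integral {0..T} (\<lambda>t. (\<integral>z. f z \<partial>m) * w t)"
    by (intro Henstock_Kurzweil_Integration.integral_cong)
      (simp add: measure_preserving_flow_integral[OF assms(2,3) flow _ borel_measurable_continuous_onI[OF f]])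
  finally show "(\<integral>z. integral {0..T} (\<lambda>t. f (\<Phi> t z) * w t) \<partial>m) = (\<integral>z. f z \<partial>m) * integral {0..T} w"
    by simp
qed

section \<open>Constant potentials\<close>

text \<open>The generalised sine; its values outside \<open>{0..T}\<close> are unspecified.\<close>
definition gsin :: "real \<Rightarrow> real \<Rightarrow> real \<Rightarrow> real" where
  "gsin T a = (SOME y. \<exists>v. jacobi T (\<lambda>_. a) y v)"

definition gsin_stop :: "real \<Rightarrow> real \<Rightarrow> real" where
  "gsin_stop T a = stopped {0..T} (gsin T a) T"

text \<open>While \<open>gsin T a\<close> is positive on \<open>{0<..<T}\<close>, this kernel is minus the variational derivative of
  \<open>y T\<close> with respect to the potential, at the constant potential \<open>a\<close>.\<close>
definition gsin_kernel :: "real \<Rightarrow> real \<Rightarrow> real \<Rightarrow> real" where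
  "gsin_kernel T a t = (if \<forall>t\<in>{0<..<T}. 0 < gsin T a t then gsin T a t * gsin T a (T - t) else 0)"

lemma jacobi_gsin:
  assumes "0 < T"
  shows "\<exists>v. jacobi T (\<lambda>_. a) (gsin T a) v"
proof -
  have "\<exists>y v. jacobi T (\<lambda>_. a) y v"
    using assms by (intro jacobi_exists) auto
  then show ?thesis unfolding gsin_def by (rule someI_ex)
qed

lemma gsin_stop_nonneg: "0 < T \<Longrightarrow> 0 \<le> gsin_stop T a"
  using jacobi_gsin[of T a] stopped_nonneg unfolding gsin_stop_def by blast

lemma stopped_le_gsin_stop:
  assumes "jacobi T q y v" "0 < T" "\<And>t. t \<in> {0..T} \<Longrightarrow> a \<le> q t"
  shows "stopped {0..T} y T \<le> gsin_stop T a"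
  using jacobi_gsin[OF \<open>0 < T\<close>, of a] stopped_antimono[OF _ assms] unfolding gsin_stop_def by blast

lemma gsin_stop_antimono:
  assumes "0 < T" "a \<le> b"
  shows "gsin_stop T b \<le> gsin_stop T a"
  using jacobi_gsin[OF \<open>0 < T\<close>, of b] stopped_le_gsin_stop[of T "\<lambda>_. b"] assms
  unfolding gsin_stop_def[of _ b] by blast

text \<open>Uniqueness comes from Sturm comparison applied in both directions with equal
  potentials.\<close>

lemma stopped_const_eq_gsin_stop:
  assumes J: "jacobi T (\<lambda>_. a) y v" and "0 < T"
  shows "stopped {0..T} y T = gsin_stop T a"
proof (rule antisym)
  show "stopped {0..T} y T \<le> gsin_stop T a"
    by (rule stopped_le_gsin_stop[OF assms]) simp
  show "gsin_stop T a \<le> stopped {0..T} y T"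
    using jacobi_gsin[OF \<open>0 < T\<close>, of a] stopped_antimono[OF J _ \<open>0 < T\<close>] unfolding gsin_stop_def by blast
qed

lemma gsin_kernel_eq:
  shows "\<forall>t\<in>{0<..<T}. 0 < gsin T a t \<Longrightarrow> gsin_kernel T a = (\<lambda>t. gsin T a t * gsin T a (T - t))"
    and "\<not> (\<forall>t\<in>{0<..<T}. 0 < gsin T a t) \<Longrightarrow> gsin_kernel T a = (\<lambda>_. 0)"
  unfolding gsin_kernel_def[abs_def] by (rule ext, rule if_P if_not_P, assumption)+

lemma gsin_kernel_continuous:
  assumes "0 < T"
  shows "continuous_on {0..T} (gsin_kernel T a)"
proof -
  obtain v where "jacobi T (\<lambda>_. a) (gsin T a) v" using jacobi_gsin[OF assms] by blast
  then have c: "continuous_on {0..T} (gsin T a)" by (rule jacobi_continuous)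
  have "continuous_on {0..T} (\<lambda>t. gsin T a (T - t))"
    by (rule continuous_on_compose2[OF c]) (auto intro!: continuous_intros)
  then have "continuous_on {0..T} (\<lambda>t. gsin T a t * gsin T a (T - t))"
    by (intro continuous_intros c)
  then show ?thesis
    using gsin_kernel_eq[of T a] continuous_on_const[of "{0..T}" "0::real"] by metis
qed

lemma gsin_kernel_nonneg:
  assumes "0 < T" "t \<in> {0..T}"
  shows "0 \<le> gsin_kernel T a t"
proof (cases "\<forall>t\<in>{0<..<T}. 0 < gsin T a t")
  case True
  obtain v where "jacobi T (\<lambda>_. a) (gsin T a) v" using jacobi_gsin[OF assms(1)] by blast
  then have "0 \<le> gsin T a t" if "t \<in> {0..T}" for t
    by (rule jacobi_nonneg[OF _ _ order_refl that]) (use True in simp)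
  then show ?thesis unfolding gsin_kernel_def using assms(2) by auto
next
  case False
  then show ?thesis unfolding gsin_kernel_def by (simp only: if_False)
qed

text \<open>If \<open>gsin T a\<close> vanishes before \<open>T\<close>, its stopped value is 0 and
  dominates that of \<open>y1\<close>, so the bound holds with the zero kernel too.\<close>

lemma stopped_diff_le_gsin_kernel:
  assumes Y1: "jacobi T q1 y1 v1" and Y2: "jacobi T q2 y2 v2" and "0 < T"
    and cont: "continuous_on {0..T} q1" "continuous_on {0..T} q2"
    and a: "\<And>t. t \<in> {0..T} \<Longrightarrow> a \<le> q1 t" and le: "\<And>t. t \<in> {0..T} \<Longrightarrow> q1 t \<le> q2 t"
  shows "stopped {0..T} y1 T - stopped {0..T} y2 T
    \<le> integral {0..T} (\<lambda>t. (q2 t - q1 t) * gsin_kernel T a t)"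
proof -
  obtain v where S: "jacobi T (\<lambda>_. a) (gsin T a) v" using jacobi_gsin[OF \<open>0 < T\<close>] by blast
  show ?thesis
  proof (cases "\<forall>t\<in>{0<..<T}. 0 < gsin T a t")
    case True
    then show ?thesis
      using stopped_diff_le[OF Y1 Y2 S \<open>0 < T\<close> cont a le] by (simp add: gsin_kernel_eq(1)[OF True])
  next
    case False
    have "gsin_stop T a = 0"
      unfolding gsin_stop_def using stopped_cases[OF S \<open>0 < T\<close>] if_not_P[OF False] by metis
    then show ?thesis
      using stopped_le_gsin_stop[OF Y1 \<open>0 < T\<close> a] stopped_nonneg[OF Y2 \<open>0 < T\<close>]
      by (simp add: gsin_kernel_eq(2)[OF False])
  qed
qed

lemma gsin_stop_diff_ge:
  assumes "0 < T" "0 \<le> h"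
  shows "h * integral {0..T} (gsin_kernel T a) \<le> gsin_stop T (a - h) - gsin_stop T a"
proof (cases "\<forall>t\<in>{0<..<T}. 0 < gsin T a t")
  case True
  obtain v w where "jacobi T (\<lambda>_. a) (gsin T a) v" "jacobi T (\<lambda>_. a - h) (gsin T (a - h)) w"
    using jacobi_gsin[OF \<open>0 < T\<close>] by metis
  then show ?thesis
    using stopped_const_diff_ge[of T a h _ w _ v] assms True unfolding gsin_stop_def gsin_kernel_eq(1)[OF True] by simp
next
  case False
  then show ?thesis
    using gsin_stop_antimono[OF \<open>0 < T\<close>, of "a - h" a] assms by (simp add: gsin_kernel_eq(2)[OF False])
qed

section \<open>Powers of stopped values\<close>

text \<open>The convex power function lies above its tangent at \<open>a\<close>. Either order of
  \<open>a\<close> and \<open>b\<close> is allowed, and both orders occur below.\<close>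

lemma power_Suc_diff_le:
  fixes a b :: real
  assumes "0 \<le> a" "0 \<le> b"
  shows "a ^ Suc n - b ^ Suc n \<le> real (Suc n) * a ^ n * (a - b)"
proof (induction n)
  case (Suc n)
  have "0 \<le> (a ^ Suc n - b ^ Suc n) * (a - b)"
  proof (cases "a \<le> b")
    case True
    then show ?thesis using assms by (intro mult_nonpos_nonpos) (simp_all add: power_mono del: power_Suc)
  next
    case False
    then show ?thesis using assms by (intro mult_nonneg_nonneg) (simp_all add: power_mono del: power_Suc)
  qed
  moreover have "a * (a ^ Suc n - b ^ Suc n) \<le> a * (real (Suc n) * a ^ n * (a - b))"
    using Suc assms by (intro mult_left_mono)
  ultimately show ?case by (simp add: algebra_simps)
qed simp

text \<open>Sturm comparison replaces the tangent slope at the value of \<open>y1\<close> by one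
  depending on the level \<open>a\<close> alone, so it can leave the integral over the
  space.\<close>

lemma stopped_power_diff_le:
  assumes Y1: "jacobi T q1 y1 v1" and Y2: "jacobi T q2 y2 v2" and "0 < T"
    and cont: "continuous_on {0..T} q1" "continuous_on {0..T} q2"
    and a: "\<And>t. t \<in> {0..T} \<Longrightarrow> a \<le> q1 t" and le: "\<And>t. t \<in> {0..T} \<Longrightarrow> q1 t \<le> q2 t"
  shows "stopped {0..T} y1 T ^ Suc n - stopped {0..T} y2 T ^ Suc n
    \<le> real (Suc n) * gsin_stop T a ^ n * integral {0..T} (\<lambda>t. (q2 t - q1 t) * gsin_kernel T a t)"
proof -
  let ?Y1 = "stopped {0..T} y1 T" and ?Y2 = "stopped {0..T} y2 T"
  let ?I = "integral {0..T} (\<lambda>t. (q2 t - q1 t) * gsin_kernel T a t)"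
  have nn: "0 \<le> ?Y1" "0 \<le> ?Y2"
    using stopped_nonneg[OF Y1 \<open>0 < T\<close>] stopped_nonneg[OF Y2 \<open>0 < T\<close>] .
  have "0 \<le> ?I"
    by (intro integral_nonneg integrable_continuous_real continuous_intros cont gsin_kernel_continuous
        mult_nonneg_nonneg gsin_kernel_nonneg \<open>0 < T\<close>) (use le in auto)
  have "?Y1 ^ Suc n - ?Y2 ^ Suc n \<le> real (Suc n) * ?Y1 ^ n * (?Y1 - ?Y2)"
    by (rule power_Suc_diff_le[OF nn])
  also have "\<dots> \<le> real (Suc n) * ?Y1 ^ n * ?I"
    using nn by (intro mult_left_mono stopped_diff_le_gsin_kernel[OF Y1 Y2 \<open>0 < T\<close> cont a le]) auto
  also have "\<dots> \<le> real (Suc n) * gsin_stop T a ^ n * ?I"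
    using nn stopped_le_gsin_stop[OF Y1 \<open>0 < T\<close> a] \<open>0 \<le> ?I\<close>
    by (intro mult_right_mono mult_left_mono power_mono) auto
  finally show ?thesis .
qed

text \<open>The tangent at level \<open>a\<close> gives the same factor as in
  \<open>stopped_power_diff_le\<close>, so the two bounds can be chained.\<close>

lemma gsin_stop_power_diff_ge:
  assumes "0 < T" "0 \<le> h"
  shows "h * (real (Suc n) * gsin_stop T a ^ n * integral {0..T} (gsin_kernel T a))
    \<le> gsin_stop T (a - h) ^ Suc n - gsin_stop T a ^ Suc n"
proof -
  have "real (Suc n) * gsin_stop T a ^ n * (h * integral {0..T} (gsin_kernel T a))
     \<le> real (Suc n) * gsin_stop T a ^ n * (gsin_stop T (a - h) - gsin_stop T a)"
    using gsin_stop_nonneg[OF \<open>0 < T\<close>] by (intro mult_left_mono gsin_stop_diff_ge[OF assms]) simp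
  also have "\<dots> \<le> gsin_stop T (a - h) ^ Suc n - gsin_stop T a ^ Suc n"
    using power_Suc_diff_le[OF gsin_stop_nonneg[OF \<open>0 < T\<close>] gsin_stop_nonneg[OF \<open>0 < T\<close>], of a n "a - h"]
    by (simp add: algebra_simps)
  finally show ?thesis by (simp add: mult_ac)
qed

lemma antimono_gsin_stop_power: "0 < T \<Longrightarrow> antimono (\<lambda>a. gsin_stop T a ^ n)"
  by (intro antimonoI power_mono gsin_stop_antimono gsin_stop_nonneg)

text \<open>Monotone functions are Borel, and \<open>P A\<close> bounds the composition.\<close>

lemma integrable_antimono_nonneg:
  fixes P :: "real \<Rightarrow> real"
  assumes "finite_measure m" and mono: "antimono P" and P0: "\<And>a. 0 \<le> P a"
    and f: "f \<in> borel_measurable m" and A: "\<And>z. A \<le> f z"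
  shows "integrable m (\<lambda>z. P (f z))"
proof -
  interpret finite_measure m by fact
  show ?thesis
  proof (rule integrable_const_bound[of _ "P A"])
    show "AE z in m. norm (P (f z)) \<le> P A"
      using P0 A by (auto intro!: antimonoD[OF mono])
    have "mono (\<lambda>a. - P a)" using mono by (simp add: mono_def antimono_def)
    then have "(\<lambda>a. - P a) \<in> borel_measurable borel" by (rule borel_measurable_mono)
    then have "P \<in> borel_measurable borel" by simp
    then show "(\<lambda>z. P (f z)) \<in> borel_measurable m"
      using measurable_compose[OF f] by blast
  qed
qed

text \<open>A Lipschitz bound, uniform for levels above \<open>A\<close>, which later removes the
  shift \<open>2 * h\<close>.\<close>

lemma gsin_stop_power_shift_le:
  assumes "0 < T" "A \<le> a" "0 \<le> h" "h \<le> 1"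
  shows "gsin_stop T (a - h) ^ Suc n
    \<le> gsin_stop T a ^ Suc n + h * (real (Suc n) * gsin_stop T (A - 1) ^ n * gsin_stop T (A - 2))"
proof -
  obtain v w where J: "jacobi T (\<lambda>_. a - h) (gsin T (a - h)) v" "jacobi T (\<lambda>_. a) (gsin T a) w"
    using jacobi_gsin[OF \<open>0 < T\<close>] by metis
  let ?W = "integral {0..T} (gsin_kernel T (a - h))"
  \<comment> \<open>A unit step in \<open>gsin_stop_diff_ge\<close> bounds the kernel integral by a
    stopped value.\<close>
  have "?W \<le> gsin_stop T (a - h - 1)"
    using gsin_stop_diff_ge[OF \<open>0 < T\<close>, of 1 "a - h"] gsin_stop_nonneg[OF \<open>0 < T\<close>, of "a - h"] by linarith
  also have "\<dots> \<le> gsin_stop T (A - 2)"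
    by (rule gsin_stop_antimono) (use assms in auto)
  finally have W: "?W \<le> gsin_stop T (A - 2)" .
  have W0: "0 \<le> ?W"
    by (intro integral_nonneg integrable_continuous_real gsin_kernel_continuous gsin_kernel_nonneg \<open>0 < T\<close>)
  have "gsin_stop T (a - h) ^ Suc n - gsin_stop T a ^ Suc n
     \<le> real (Suc n) * gsin_stop T (a - h) ^ n * integral {0..T} (\<lambda>t. (a - (a - h)) * gsin_kernel T (a - h) t)"
    unfolding gsin_stop_def[of T a] gsin_stop_def[of T "a - h"]
    by (rule stopped_power_diff_le[OF J \<open>0 < T\<close>, of "a - h", unfolded gsin_stop_def]) (use \<open>0 \<le> h\<close> in auto)
  also have "\<dots> = h * (real (Suc n) * gsin_stop T (a - h) ^ n * ?W)"
    by simp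
  also have "\<dots> \<le> h * (real (Suc n) * gsin_stop T (A - 1) ^ n * gsin_stop T (A - 2))"
    by (intro mult_left_mono mult_mono power_mono gsin_stop_antimono W W0)
      (use assms gsin_stop_nonneg[OF \<open>0 < T\<close>] in auto)
  finally show ?thesis by linarith
qed

text \<open>Summation by parts over the level sets of \<open>max x \<lambda>\<^sub>i\<close> with \<open>\<lambda>\<^sub>i = A + i h\<close>.\<close>
lemma level_sum_le:
  fixes P :: "real \<Rightarrow> real"
  assumes "antimono P" "0 < h"
  shows "(\<Sum>i<n. (max x (A + real (Suc i) * h) - max x (A + real i * h)) / h
            * (P (A + real i * h - h) - P (A + real i * h)))
    \<le> max 0 (P (x - 2 * h) - P (A + real n * h - h))"
proof (induction n)
  case (Suc n)
  let ?l = "A + real n * h"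
  have l: "A + real (Suc n) * h = ?l + h" by (simp add: algebra_simps)
  have mono: "P b \<le> P a" if "a \<le> b" for a b
    using antimonoD[OF assms(1) that] .
  show ?case
  proof (cases "?l + h \<le> x")
    case True
    then have "max x (?l + h) - max x ?l = 0" using assms by simp
    moreover have "P ?l \<le> P (?l - h)" by (rule mono) (use assms in simp)
    ultimately show ?thesis using Suc.IH unfolding sum.lessThan_Suc l by simp
  next
    case False
    have "(max x (?l + h) - max x ?l) / h \<le> 1" using assms(2) by simp
    moreover have "0 \<le> P (?l - h) - P ?l" using mono[of "?l - h" ?l] assms by simp
    ultimately have "(max x (?l + h) - max x ?l) / h * (P (?l - h) - P ?l) \<le> 1 * (P (?l - h) - P ?l)"
      by (rule mult_right_mono)
    \<comment> \<open>From \<open>x < ?l + h\<close> follows \<open>x - 2 * h < ?l - h\<close>: the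
      origin of the shift by \<open>2 * h\<close>.\<close>
    moreover have "P (?l - h) \<le> P (x - 2 * h)" by (rule mono) (use False in simp)
    ultimately show ?thesis using Suc.IH unfolding sum.lessThan_Suc l by simp
  qed
qed simp

lemma stopped_Ici_eq_Icc:
  "0 \<le> T \<Longrightarrow> stopped {0..} y T = stopped {0..T} y T"
proof -
  assume "0 \<le> T"
  have "(\<exists>\<tau>. first_positive_zero {0..} y \<tau> \<and> \<tau> < T) \<longleftrightarrow> (\<exists>\<tau>. first_positive_zero {0..T} y \<tau> \<and> \<tau> < T)"
    unfolding first_positive_zero_def by (rule iff_exI) auto
  then show ?thesis unfolding stopped_def by simp
qed

section \<open>The inequality\<close>

lemma stopped_power_integral_le_shift:
  fixes m :: "'a::metric_space measure" and K :: "'a \<Rightarrow> real"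
  assumes "0 < T" and cpt: "compact (UNIV :: 'a set)" and ps: "prob_space m" and sets: "sets m = sets borel"
    and K: "continuous_on UNIV K" and flow: "measure_preserving_flow T m \<Phi>"
    and J: "\<And>z. jacobi T (\<lambda>t. K (\<Phi> t z)) (y z) (v z)"
    and AK: "\<And>z. A \<le> K z" and KB: "\<And>z. K z \<le> A + real N * h" and "0 < h"
  shows "(\<integral>z. stopped {0..T} (y z) T ^ Suc n \<partial>m) \<le> (\<integral>z. gsin_stop T (K z - 2 * h) ^ Suc n \<partial>m)"
proof -
  interpret prob_space m by (rule ps)
  define l where "l i = A + real i * h" for i :: nat
  define \<psi> where "\<psi> i x = max x (l (Suc i)) - max x (l i)" for i x
  define P where "P a = gsin_stop T a ^ Suc n" for a
  define c where "c i = real (Suc n) * gsin_stop T (l i) ^ n" for i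
  have l_le: "l i \<le> l (Suc i)" for i
    using \<open>0 < h\<close> by (simp add: l_def algebra_simps)
  have P0: "0 \<le> P a" for a
    by (simp add: P_def gsin_stop_nonneg[OF \<open>0 < T\<close>] del: power_Suc)
  have c0: "0 \<le> c i" for i
    by (simp add: c_def gsin_stop_nonneg[OF \<open>0 < T\<close>])
  have Pmono: "antimono P"
    unfolding P_def by (rule antimono_gsin_stop_power[OF \<open>0 < T\<close>])
  have \<psi>_cont: "continuous_on UNIV (\<lambda>z. \<psi> i (K z))" for i
    unfolding \<psi>_def by (intro continuous_intros K)
  have \<psi>0: "0 \<le> \<psi> i x" for i x
    using l_le[of i] by (auto simp: \<psi>_def max_def)
  have K_flow: "continuous_on {0..T} (\<lambda>t. K (\<Phi> t z))" for z
  proof -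
    have c: "continuous_on ({0..T} \<times> UNIV) (\<lambda>(t, z). \<Phi> t z)"
      using flow unfolding measure_preserving_flow_def by blast
    have "continuous_on {0..T} (\<lambda>t. \<Phi> t z)"
      using continuous_on_compose2[OF c, of "{0..T}" "\<lambda>t. (t, z)"] by (force intro!: continuous_intros)
    then show ?thesis by (rule continuous_on_compose2[OF K]) auto
  qed
  have pointwise: "stopped {0..T} (y z) T ^ Suc n
     \<le> P (l N) + (\<Sum>i<N. c i * integral {0..T} (\<lambda>t. \<psi> i (K (\<Phi> t z)) * gsin_kernel T (l i) t))" for z
  proof -
    \<comment> \<open>Since \<open>A \<le> K\<close>, the family starts at the given potential; its
      last member is at least \<open>l N\<close>, which bounds the remaining term by
      \<open>P (l N)\<close>.\<close>
    define q where "q i t = max (K (\<Phi> t z)) (l i)" for i t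
    have q: "continuous_on {0..T} (q i)" for i
      unfolding q_def by (intro continuous_intros K_flow)
    then have "\<forall>i. \<exists>u w. jacobi T (q i) u w"
      using jacobi_exists \<open>0 < T\<close> by (meson less_imp_le)
    then obtain u w where U: "\<And>i. jacobi T (q i) (u i) (w i)" by metis
    define f where "f i = stopped {0..T} (u i) T" for i
    have f0: "0 \<le> f i" for i
      unfolding f_def by (rule stopped_nonneg[OF U \<open>0 < T\<close>])
    have "stopped {0..T} (y z) T \<le> f 0"
      unfolding f_def by (rule stopped_antimono[OF U J \<open>0 < T\<close>]) (simp add: q_def l_def AK)
    then have "stopped {0..T} (y z) T ^ Suc n \<le> f 0 ^ Suc n"
      by (rule power_mono) (rule stopped_nonneg[OF J \<open>0 < T\<close>])
    also have "f 0 ^ Suc n = f N ^ Suc n + (\<Sum>i<N. f i ^ Suc n - f (Suc i) ^ Suc n)"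
      by (subst sum_lessThan_telescope') simp
    also have "f N ^ Suc n \<le> P (l N)"
      unfolding P_def
    proof (rule power_mono[OF _ f0])
      show "f N \<le> gsin_stop T (l N)"
        unfolding f_def by (rule stopped_le_gsin_stop[OF U \<open>0 < T\<close>]) (simp add: q_def)
    qed
    also have "(\<Sum>i<N. f i ^ Suc n - f (Suc i) ^ Suc n)
       \<le> (\<Sum>i<N. c i * integral {0..T} (\<lambda>t. \<psi> i (K (\<Phi> t z)) * gsin_kernel T (l i) t))"
    proof (rule sum_mono)
      fix i
      have "f i ^ Suc n - f (Suc i) ^ Suc n
        \<le> real (Suc n) * gsin_stop T (l i) ^ n * integral {0..T} (\<lambda>t. (q (Suc i) t - q i t) * gsin_kernel T (l i) t)"
        unfolding f_def
        by (rule stopped_power_diff_le[OF U U \<open>0 < T\<close> q q])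
          (use l_le[of i] in \<open>auto simp: q_def max_def\<close>)
      then show "f i ^ Suc n - f (Suc i) ^ Suc n
        \<le> c i * integral {0..T} (\<lambda>t. \<psi> i (K (\<Phi> t z)) * gsin_kernel T (l i) t)"
        by (simp only: c_def \<psi>_def q_def)
    qed
    finally show ?thesis by simp
  qed
  note swap = measure_preserving_flow_time_integral[OF cpt finite_measure_axioms sets flow
      \<psi>_cont gsin_kernel_continuous[OF \<open>0 < T\<close>]]
  have intg\<psi>: "integrable m (\<lambda>z. \<psi> i (K z))" for i
  proof (rule integrable_const_bound[of _ h])
    show "AE z in m. norm (\<psi> i (K z)) \<le> h"
      using \<open>0 < h\<close> by (intro AE_I2) (auto simp: \<psi>_def l_def algebra_simps)
    show "(\<lambda>z. \<psi> i (K z)) \<in> borel_measurable m"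
      using borel_measurable_continuous_onI[OF \<psi>_cont] by (simp add: measurable_cong_sets[OF sets refl])
  qed
  have intgP: "integrable m (\<lambda>z. P (K z - 2 * h))"
  proof (rule integrable_antimono_nonneg[OF finite_measure_axioms Pmono P0])
    show "(\<lambda>z. K z - 2 * h) \<in> borel_measurable m"
      using borel_measurable_continuous_onI[OF K] by (simp add: measurable_cong_sets[OF sets refl])
    show "A - 2 * h \<le> K z - 2 * h" for z using AK[of z] by simp
  qed
  have "(\<integral>z. stopped {0..T} (y z) T ^ Suc n \<partial>m)
     \<le> (\<integral>z. P (l N) + (\<Sum>i<N. c i * integral {0..T} (\<lambda>t. \<psi> i (K (\<Phi> t z)) * gsin_kernel T (l i) t)) \<partial>m)"
  \<comment> \<open>Measurability of the left integrand in \<open>z\<close> is not established. Only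
    the majorant has to be integrable and nonnegative, since a non-integrable function has integral
    0 by convention.\<close>
  proof (rule integral_mono')
    show "integrable m (\<lambda>z. P (l N) + (\<Sum>i<N. c i * integral {0..T} (\<lambda>t. \<psi> i (K (\<Phi> t z)) * gsin_kernel T (l i) t)))"
      by (intro Bochner_Integration.integrable_add integrable_const Bochner_Integration.integrable_sum integrable_mult_right swap(1))
    fix z
    show "stopped {0..T} (y z) T ^ Suc n
      \<le> P (l N) + (\<Sum>i<N. c i * integral {0..T} (\<lambda>t. \<psi> i (K (\<Phi> t z)) * gsin_kernel T (l i) t))"
      by (rule pointwise)
    have "0 \<le> stopped {0..T} (y z) T ^ Suc n"
      by (intro zero_le_power stopped_nonneg[OF J \<open>0 < T\<close>])
    then show "0 \<le> P (l N) + (\<Sum>i<N. c i * integral {0..T} (\<lambda>t. \<psi> i (K (\<Phi> t z)) * gsin_kernel T (l i) t))"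
      using pointwise[of z] by linarith
  qed
  also have "\<dots> = P (l N) + (\<Sum>i<N. c i * ((\<integral>z. \<psi> i (K z) \<partial>m) * integral {0..T} (gsin_kernel T (l i))))"
    by (simp add: Bochner_Integration.integral_add Bochner_Integration.integral_sum swap prob_space)
  \<comment> \<open>The weight at level \<open>l i\<close> is traded for a difference quotient of
    \<open>P\<close>, preparing the sum for \<open>level_sum_le\<close>.\<close>
  also have "\<dots> \<le> P (l N) + (\<Sum>i<N. (\<integral>z. \<psi> i (K z) \<partial>m) / h * (P (l i - h) - P (l i)))"
  proof (intro add_left_mono sum_mono)
    fix i
    have "0 \<le> (\<integral>z. \<psi> i (K z) \<partial>m) / h" using \<psi>0 \<open>0 < h\<close> by simp
    then have "(\<integral>z. \<psi> i (K z) \<partial>m) / h * (h * (c i * integral {0..T} (gsin_kernel T (l i))))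
      \<le> (\<integral>z. \<psi> i (K z) \<partial>m) / h * (P (l i - h) - P (l i))"
      unfolding c_def P_def using \<open>0 < h\<close> by (intro mult_left_mono gsin_stop_power_diff_ge \<open>0 < T\<close>) auto
    then show "c i * ((\<integral>z. \<psi> i (K z) \<partial>m) * integral {0..T} (gsin_kernel T (l i)))
      \<le> (\<integral>z. \<psi> i (K z) \<partial>m) / h * (P (l i - h) - P (l i))"
      using \<open>0 < h\<close> by (simp add: mult_ac)
  qed
  also have "\<dots> = (\<integral>z. P (l N) + (\<Sum>i<N. \<psi> i (K z) / h * (P (l i - h) - P (l i))) \<partial>m)"
    by (simp add: Bochner_Integration.integral_add Bochner_Integration.integral_sum intg\<psi> prob_space)
  also have "\<dots> \<le> (\<integral>z. P (K z - 2 * h) \<partial>m)"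
  proof (rule integral_mono[OF _ intgP])
    show "integrable m (\<lambda>z. P (l N) + (\<Sum>i<N. \<psi> i (K z) / h * (P (l i - h) - P (l i))))"
      by (intro Bochner_Integration.integrable_add integrable_const Bochner_Integration.integrable_sum integrable_mult_left integrable_divide intg\<psi>)
    fix z
    have "(\<Sum>i<N. \<psi> i (K z) / h * (P (l i - h) - P (l i))) \<le> max 0 (P (K z - 2 * h) - P (l N - h))"
      using level_sum_le[OF Pmono \<open>0 < h\<close>, where x = "K z" and A = A and n = N] by (simp only: \<psi>_def l_def)
    moreover have "P (l N - h) \<le> P (K z - 2 * h)"
      using KB[of z] \<open>0 < h\<close> by (intro antimonoD[OF Pmono]) (simp add: l_def)
    moreover have "P (l N) \<le> P (l N - h)"
      using \<open>0 < h\<close> by (intro antimonoD[OF Pmono]) simp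
    ultimately show "P (l N) + (\<Sum>i<N. \<psi> i (K z) / h * (P (l i - h) - P (l i))) \<le> P (K z - 2 * h)"
      by linarith
  qed
  finally show ?thesis unfolding P_def .
qed

theorem theorem6:
  fixes T :: real
    and m :: "'a::metric_space measure"
    and K :: "'a \<Rightarrow> real"
    and \<Phi> :: "real \<Rightarrow> 'a \<Rightarrow> 'a"
    and j :: "'a \<Rightarrow> real \<Rightarrow> real"
    and s :: "real \<Rightarrow> real \<Rightarrow> real"
    and \<mu> :: nat
  assumes "0 < T"
    and "compact (UNIV :: 'a set)"
    and "prob_space m" and "sets m = sets borel"
    and "continuous_on UNIV K"
    and "measure_preserving_flow T m \<Phi>"
    and "\<And>z. stopped_solution {0..T} (\<lambda>t. K (\<Phi> t z)) 0 1 (j z)"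
    and "\<And>a. stopped_solution {0..} (\<lambda>_. a) 0 1 (s a)"
    and "0 < \<mu>"
  shows "(\<integral>z. j z T ^ \<mu> \<partial>m) \<le> (\<integral>z. s (K z) T ^ \<mu> \<partial>m)"
proof -
  interpret prob_space m by fact
  obtain n where n: "\<mu> = Suc n" using \<open>0 < \<mu>\<close> by (cases \<mu>) auto
  have "\<forall>z. \<exists>y v. jacobi T (\<lambda>t. K (\<Phi> t z)) y v \<and> j z T = stopped {0..T} y T"
  proof
    fix z
    obtain y where "ivp_solution {0..T} (\<lambda>t. K (\<Phi> t z)) 0 1 y" "j z T = stopped {0..T} y T"
      using assms(7)[of z] \<open>0 < T\<close> unfolding stopped_solution_def by auto
    then show "\<exists>y v. jacobi T (\<lambda>t. K (\<Phi> t z)) y v \<and> j z T = stopped {0..T} y T"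
      using ivp_solution_imp_jacobi[OF _ order_refl] by blast
  qed
  then obtain y v where J: "\<And>z. jacobi T (\<lambda>t. K (\<Phi> t z)) (y z) (v z)"
      and j: "\<And>z. j z T = stopped {0..T} (y z) T"
    by metis
  have s: "s a T = gsin_stop T a" for a
  proof -
    obtain u where u: "ivp_solution {0..} (\<lambda>_. a) 0 1 u" "s a T = stopped {0..} u T"
      using assms(8)[of a] \<open>0 < T\<close> unfolding stopped_solution_def by auto
    obtain w where "jacobi T (\<lambda>_. a) u w"
      using ivp_solution_imp_jacobi[OF u(1), of T] by auto
    then show ?thesis
      using u(2) \<open>0 < T\<close> by (simp add: stopped_Ici_eq_Icc stopped_const_eq_gsin_stop)
  qed
  have "bounded (range K)"
    by (intro compact_imp_bounded compact_continuous_image assms)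
  then obtain C where C: "0 < C" "\<And>z. \<bar>K z\<bar> \<le> C"
    unfolding bounded_pos by auto
  have C': "- C \<le> K z" "K z \<le> C" for z using C(2)[of z] by auto
  define D where "D = real (Suc n) * gsin_stop T (- C - 1) ^ n * gsin_stop T (- C - 2)"
  have D0: "0 \<le> D" by (simp add: D_def gsin_stop_nonneg[OF \<open>0 < T\<close>])
  define P where "P a = gsin_stop T a ^ Suc n" for a
  have P0: "0 \<le> P a" for a
    by (simp add: P_def gsin_stop_nonneg[OF \<open>0 < T\<close>] del: power_Suc)
  have Pmono: "antimono P"
    unfolding P_def by (rule antimono_gsin_stop_power[OF \<open>0 < T\<close>])
  have intgP: "integrable m (\<lambda>z. P (K z - b))" for b
  proof (rule integrable_antimono_nonneg[OF finite_measure_axioms Pmono P0])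
    show "(\<lambda>z. K z - b) \<in> borel_measurable m"
      using borel_measurable_continuous_onI[OF assms(5)] by (simp add: measurable_cong_sets[OF assms(4) refl])
    show "- C - b \<le> K z - b" for z using C'(1)[of z] by simp
  qed
  show ?thesis
  proof (rule field_le_epsilon)
    fix e :: real assume "0 < e"
    \<comment> \<open>With \<open>h = 2 * C / N\<close>, the \<open>N\<close> levels cover
      \<open>{- C..C}\<close>. The two summands of \<open>1 + D / e\<close> give
      \<open>2 * h \<le> 1\<close>, as the Lipschitz bound requires, and
      \<open>2 * h * D \<le> e\<close>.\<close>
    obtain N :: nat where N: "4 * C * (1 + D / e) < real N"
      using reals_Archimedean2 by blast
    have "0 < 4 * C * (1 + D / e)" using C(1) D0 \<open>0 < e\<close> by (intro mult_pos_pos add_pos_nonneg) auto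
    then have N0: "0 < real N" using N by linarith
    define h where "h = 2 * C / real N"
    have h0: "0 < h" using C(1) N0 by (simp add: h_def)
    have "2 * h * (1 + D / e) \<le> 1"
      using N N0 by (simp add: h_def field_simps)
    then have *: "2 * h + 2 * h * (D / e) \<le> 1" by (simp add: distrib_left)
    moreover have "0 \<le> 2 * h * (D / e)" using h0 D0 \<open>0 < e\<close> by auto
    ultimately have h1: "2 * h \<le> 1" and "2 * h * (D / e) \<le> 1" using h0 by linarith+
    then have he: "2 * h * D \<le> e" using \<open>0 < e\<close> by (simp add: field_simps)
    have KB: "K z \<le> - C + real N * h" for z using C'(2)[of z] N0 by (simp add: h_def)
    have "(\<integral>z. j z T ^ \<mu> \<partial>m) \<le> (\<integral>z. P (K z - 2 * h) \<partial>m)"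
      unfolding j n P_def
      by (rule stopped_power_integral_le_shift[OF assms(1-6) J C'(1) KB h0])
    also have "\<dots> \<le> (\<integral>z. P (K z) + 2 * h * D \<partial>m)"
    proof (rule integral_mono[OF intgP])
      show "integrable m (\<lambda>z. P (K z) + 2 * h * D)"
        using intgP[of 0] by simp
      show "P (K z - 2 * h) \<le> P (K z) + 2 * h * D" for z
        unfolding P_def D_def
        by (rule gsin_stop_power_shift_le[OF \<open>0 < T\<close> C'(1)]) (use h0 h1 in auto)
    qed
    also have "\<dots> = (\<integral>z. P (K z) \<partial>m) + 2 * h * D"
      using intgP[of 0] by (simp add: prob_space)
    also have "\<dots> \<le> (\<integral>z. s (K z) T ^ \<mu> \<partial>m) + e"
      using he by (simp add: s n P_def)
    finally show "(\<integral>z. j z T ^ \<mu> \<partial>m) \<le> (\<integral>z. s (K z) T ^ \<mu> \<partial>m) + e" .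
  qed
qed

end
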